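(* For any $n,m\ge1$, trees $s\in Y_n$, $t\in Y_m$, and $1\le i\le n$, $$M_s\circ_i M_t=\sum_{r\in Y_{n+m-1},\ P_i(r)=(s,t)}M_r .$$
   Context: $\Bbbk$ is a commutative ring. $[a,b]$ denotes an interval of integers. For a sequence $a$ of $n$ distinct integers, $\{a\}$ is its underlying set and $\mathrm{st}(a)\in S_n$ is the unique permutation with $\mathrm{st}(a)_p<\mathrm{st}(a)_q\iff a_p<a_q$. Permutations are written as lists of values. Trees. $Y_n$ is the set of rooted planar binary trees with $n$ internal nodes ($n+1$ leaves); $|t|=n$ for $t\in Y_n$; $1_0$ is the unique element of $Y_0$. The grafting $s\vee t\in Y_{|s|+|t|+1}$ is obtained by joining a new root to the roots of $s$ (left) and $t$ (right); each $t\in Y_n$, $n\ge1$, is uniquely $t=t_l\vee t_r$. $s\backslash t$ is obtained by gluing the root of $t$ to the rightmost branch of $s$ (so $1_0\backslash t=t$, $s\backslash t=s_l\vee(s_r\backslash t)$), and $s/t$ by gluing the root of $s$ to the leftmost branch of $t$ (so $s/1_0=s$, $s/t=(s/t_l)\vee t_r$). Operad $\mathcal Y$. For $s\in Y_n$, $t\in Y_m$, $1\le i\le n$, put $j:=|s_l|+1$ and define $B_i(s,t)\in Y_{n+m-1}$ recursively by $B_i(s,t)=s_l\vee B_{i-j}(s_r,t)$ if $j<i$; $B_i(s,t)=(s_l/t_l)\vee(t_r\backslash s_r)$ if $j=i$; $B_i(s,t)=B_i(s_l,t)\vee s_r$ if $j>i$. $\Bbbk Y_n$ has basis $\{F_t\}_{t\in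 Y_n}$ and the linear maps $\circ_i:\Bbbk Y_n\otimes\Bbbk Y_m\to\Bbbk Y_{n+m-1}$ are $F_s\circ_iF_t:=F_{B_i(s,t)}$. Tamari order and $M$ basis. The Tamari order on $Y_n$ is the partial order whose relations are generated by $s\le t$ whenever $t$ is obtained from $s$ by replacing some subtree of the form $(a\vee b)\vee c$ by $a\vee(b\vee c)$. With $\mu$ its Möbius function, $M_s:=\sum_{s\le t}\mu(s,t)F_t$. The map $\gamma:Y_n\to S_n$. $\gamma(1_0)$ is the empty permutation and, for $t=t_l\vee t_r\in Y_n$ with $p=|t_l|$, $q=|t_r|$, $\gamma(t)=(\gamma(t_l)_1+q,\dots,\gamma(t_l)_p+q,\ n,\ \gamma(t_r)_1,\dots,\gamma(t_r)_q)$. It is injective. The map $P_i:S_{n+m-1}\to S_n\times S_m$ ($n,m,i$ fixed). If $m=1$, $P_i(\rho):=(\rho,1)$. If $m\ge2$, for $\rho\in S_{n+m-1}$ let $\mathcal L_1(\rho)=(\rho_1,\dots,\rho_{i-1})$, $\mathcal L_2(\rho)=(\rho_i,\dots,\rho_{i+m-1})$, $\mathcal L_3(\rho)=(\rho_{i+m},\dots,\rho_{n+m-1})$, $u=\min\{\mathcal L_2(\rho)\}$, $v=\max\{\mathcal L_2(\rho)\}$; for $j=1,3$ let $C_{j,b},C_{j,m},C_{j,t}$ be the sets of elements $x$ of $\{\mathcal L_j(\rho)\}$ with $x<u$, $u<x<v$, $x>v$ respectively, and let $n_j$ be the cardinality of $C_{j,m}$. Let $B\rho\in S_{n+m-1}$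 be the permutation with $\mathrm{st}(\mathcal L_j(B\rho))=\mathrm{st}(\mathcal L_j(\rho))$, $j=1,2,3$, and $\{\mathcal L_1(B\rho)\}=C_{1,b}\cup[u,u+n_1-1]\cup C_{1,t}$, $\{\mathcal L_2(B\rho)\}=[u+n_1,v-n_3]$, $\{\mathcal L_3(B\rho)\}=C_{3,b}\cup[v-n_3+1,v]\cup C_{3,t}$. Then $P_i(\rho):=\bigl(\mathrm{st}(\mathcal L_1(B\rho),u+n_1,\mathcal L_3(B\rho)),\ \mathrm{st}(\mathcal L_2(\rho))\bigr)$. The map $P_i:Y_{n+m-1}\to Y_n\times Y_m$ is the unique map such that $(\gamma\times\gamma)(P_i(r))=P_i(\gamma(r))$ for all $r\in Y_{n+m-1}$. *)

theory Defs
  imports "HOL-Library.Poly_Mapping" "HOL-Combinatorics.Multiset_Permutations"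
begin

section \<open>Planar binary trees\<close>

text \<open>The automatically generated \<^term>\<open>size\<close> counts internal nodes: leaves have size 0.\<close>

datatype btree = Leaf | Node btree btree

definition Y :: "nat \<Rightarrow> btree set" where
  "Y n = {t. size t = n}"

text \<open>\<^term>\<open>over s t\<close> is \<open>s / t\<close>: the root of \<open>s\<close> is glued to the leftmost branch of \<open>t\<close>.
  \<^term>\<open>under s t\<close> is \<open>s \ t\<close>: the root of \<open>t\<close> is glued to the rightmost branch of \<open>s\<close>.\<close>

fun over :: "btree \<Rightarrow> btree \<Rightarrow> btree" where
  "over s Leaf = s"
| "over s (Node t1 t2) = Node (over s t1) t2"

fun under :: "btree \<Rightarrow> btree \<Rightarrow> btree" where
  "under Leaf t = t"
| "under (Node s1 s2) t = Node s1 (under s2 t)"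

text \<open>\<open>graft_at i s t\<close> is \<open>B\<^sub>i(s, t)\<close>; it is meaningful for \<open>1 \<le> i \<le> size s\<close> and \<open>1 \<le> size t\<close>,
  and only totalised by \<^term>\<open>Leaf\<close> when one of the trees is a leaf.\<close>

fun graft_at :: "nat \<Rightarrow> btree \<Rightarrow> btree \<Rightarrow> btree" where
  "graft_at i (Node s1 s2) (Node t1 t2) =
     (let j = size s1 + 1 in
      if j < i then Node s1 (graft_at (i - j) s2 (Node t1 t2))
      else if j = i then Node (over s1 t1) (under t2 s2)
      else Node (graft_at i s1 (Node t1 t2)) s2)"
| "graft_at i _ _ = Leaf"


section \<open>The Tamari order and its Moebius function\<close>

inductive rotation :: "btree \<Rightarrow> btree \<Rightarrow> bool" where
  root: "rotation (Node (Node a b) c) (Node a (Node b c))"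
| left: "rotation l l' \<Longrightarrow> rotation (Node l r) (Node l' r)"
| right: "rotation r r' \<Longrightarrow> rotation (Node l r) (Node l r')"

definition tamari :: "btree \<Rightarrow> btree \<Rightarrow> bool" where
  "tamari = rotation\<^sup>*\<^sup>*"

fun right_weight :: "btree \<Rightarrow> nat" where
  "right_weight Leaf = 0"
| "right_weight (Node l r) = right_weight l + right_weight r + size r"

lemma rotation_size: "rotation s t \<Longrightarrow> size s = size t"
  by (induction rule: rotation.induct) auto

lemma rotation_right_weight: "rotation s t \<Longrightarrow> right_weight s < right_weight t"
  by (induction rule: rotation.induct) (auto dest: rotation_size)

lemma tamari_size: "tamari s t \<Longrightarrow> size s = size t"
  unfolding tamari_def by (induction rule: rtranclp_induct) (auto dest: rotation_size)

lemma tamari_refl: "tamari s s"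
  by (simp add: tamari_def)

lemma tamari_trans: "tamari r s \<Longrightarrow> tamari s t \<Longrightarrow> tamari r t"
  by (simp add: tamari_def)

lemma tamari_right_weight: "tamari s t \<Longrightarrow> s = t \<or> right_weight s < right_weight t"
  unfolding tamari_def
  by (induction rule: rtranclp_induct) (auto dest: rotation_right_weight)

lemma tamari_antisym: "tamari s t \<Longrightarrow> tamari t s \<Longrightarrow> s = t"
  using tamari_right_weight by (metis less_asym)

lemma finite_Y: "finite (Y n)"
proof (induction n rule: less_induct)
  case (less n)
  have "Y n \<subseteq> insert Leaf ((\<lambda>(l, r). Node l r) ` ((\<Union>k<n. Y k) \<times> (\<Union>k<n. Y k)))"
  proof
    fix t assume "t \<in> Y n"
    then show "t \<in> insert Leaf ((\<lambda>(l, r). Node l r) ` ((\<Union>k<n. Y k) \<times> (\<Union>k<n. Y k)))"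
      by (cases t) (auto simp: Y_def)
  qed
  moreover have "finite (\<Union>k<n. Y k)"
    using less by blast
  ultimately show ?case
    by (meson finite_SigmaI finite_imageI finite_insert finite_subset)
qed

lemma finite_tamari_up: "finite {t. tamari s t}"
  by (rule finite_subset[OF _ finite_Y[of "size s"]]) (auto simp: Y_def dest: tamari_size)

function mobius :: "btree \<Rightarrow> btree \<Rightarrow> int" where
  "mobius s t =
     (if s = t then 1
      else if tamari s t then - (\<Sum>r | tamari s r \<and> tamari r t \<and> r \<noteq> t. mobius s r)
      else 0)"
  by pat_completeness auto
termination
  by (relation "measure (\<lambda>(s, t). right_weight t)") (auto dest: tamari_right_weight)

declare mobius.simps [simp del]


section \<open>The operad on binary trees\<close>

text \<open>The free module on all trees is the type of finitely supported functions from trees to the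
  ground ring; the span of the \<open>F\<^sub>t\<close> with \<open>t \<in> Y n\<close> consists of those with \<open>keys \<subseteq> Y n\<close>.\<close>

definition scale :: "'k::comm_ring_1 \<Rightarrow> (btree \<Rightarrow>\<^sub>0 'k) \<Rightarrow> (btree \<Rightarrow>\<^sub>0 'k)" where
  "scale c x = Poly_Mapping.map ((*) c) x"

definition F :: "btree \<Rightarrow> (btree \<Rightarrow>\<^sub>0 'k::comm_ring_1)" where
  "F t = Poly_Mapping.single t 1"

definition M :: "btree \<Rightarrow> (btree \<Rightarrow>\<^sub>0 'k::comm_ring_1)" where
  "M s = (\<Sum>t | tamari s t. scale (of_int (mobius s t)) (F t))"

text \<open>The bilinear extension of \<open>F\<^sub>s \<circ>\<^sub>i F\<^sub>t = F (B\<^sub>i(s, t))\<close>.\<close>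

definition circ :: "nat \<Rightarrow> (btree \<Rightarrow>\<^sub>0 'k::comm_ring_1) \<Rightarrow> (btree \<Rightarrow>\<^sub>0 'k) \<Rightarrow> (btree \<Rightarrow>\<^sub>0 'k)" where
  "circ i x y =
     (\<Sum>s\<in>Poly_Mapping.keys x. \<Sum>t\<in>Poly_Mapping.keys y.
        scale (Poly_Mapping.lookup x s * Poly_Mapping.lookup y t) (F (graft_at i s t)))"


section \<open>Permutations as lists of values\<close>

definition perms :: "nat \<Rightarrow> nat list set" where
  "perms n = permutations_of_set {1..n}"

text \<open>Standardization of a list of distinct numbers.\<close>

definition st :: "nat list \<Rightarrow> nat list" where
  "st a = (THE \<sigma>. \<sigma> \<in> perms (length a) \<and>
     (\<forall>p<length a. \<forall>q<length a. \<sigma> ! p < \<sigma> ! q \<longleftrightarrow> a ! p < a ! q))"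

fun gamma :: "btree \<Rightarrow> nat list" where
  "gamma Leaf = []"
| "gamma (Node l r) =
     map (\<lambda>x. x + size r) (gamma l) @ [size (Node l r)] @ gamma r"

text \<open>The three blocks of a permutation. The parameter \<open>i\<close> is 1-based, list positions are 0-based.\<close>

definition L1 :: "nat \<Rightarrow> nat \<Rightarrow> nat list \<Rightarrow> nat list" where
  "L1 m i \<rho> = take (i - 1) \<rho>"

definition L2 :: "nat \<Rightarrow> nat \<Rightarrow> nat list \<Rightarrow> nat list" where
  "L2 m i \<rho> = take m (drop (i - 1) \<rho>)"

definition L3 :: "nat \<Rightarrow> nat \<Rightarrow> nat list \<Rightarrow> nat list" where
  "L3 m i \<rho> = drop (i - 1 + m) \<rho>"

definition lo :: "nat \<Rightarrow> nat \<Rightarrow> nat list \<Rightarrow> nat" where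
  "lo m i \<rho> = Min (set (L2 m i \<rho>))"

definition hi :: "nat \<Rightarrow> nat \<Rightarrow> nat list \<Rightarrow> nat" where
  "hi m i \<rho> = Max (set (L2 m i \<rho>))"

definition mid_count :: "nat \<Rightarrow> nat \<Rightarrow> nat list \<Rightarrow> nat list \<Rightarrow> nat" where
  "mid_count m i \<rho> xs = card {x \<in> set xs. lo m i \<rho> < x \<and> x < hi m i \<rho>}"

text \<open>The permutation \<open>B\<rho>\<close>. The half-open intervals \<open>{u..<u + n1}\<close> and \<open>{v - n3<..v}\<close> are the
  integer intervals \<open>[u, u + n1 - 1]\<close> and \<open>[v - n3 + 1, v]\<close>.\<close>

definition B_perm :: "nat \<Rightarrow> nat \<Rightarrow> nat \<Rightarrow> nat list \<Rightarrow> nat list" where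
  "B_perm n m i \<rho> =
     (let u = lo m i \<rho>; v = hi m i \<rho>;
          n1 = mid_count m i \<rho> (L1 m i \<rho>); n3 = mid_count m i \<rho> (L3 m i \<rho>)
      in THE \<sigma>. \<sigma> \<in> perms (n + m - 1) \<and>
           st (L1 m i \<sigma>) = st (L1 m i \<rho>) \<and>
           st (L2 m i \<sigma>) = st (L2 m i \<rho>) \<and>
           st (L3 m i \<sigma>) = st (L3 m i \<rho>) \<and>
           set (L1 m i \<sigma>) =
             {x \<in> set (L1 m i \<rho>). x < u} \<union> {u..<u + n1} \<union> {x \<in> set (L1 m i \<rho>). x > v} \<and>
           set (L2 m i \<sigma>) = {u + n1..v - n3} \<and>
           set (L3 m i \<sigma>) =
             {x \<in> set (L3 m i \<rho>). x < u} \<union> {v - n3<..v} \<union> {x \<in> set (L3 m i \<rho>). x > v})"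

definition P_perm :: "nat \<Rightarrow> nat \<Rightarrow> nat \<Rightarrow> nat list \<Rightarrow> nat list \<times> nat list" where
  "P_perm n m i \<rho> =
     (if m = 1 then (\<rho>, [1])
      else let \<sigma> = B_perm n m i \<rho>;
               w = lo m i \<rho> + mid_count m i \<rho> (L1 m i \<rho>)
           in (st (L1 m i \<sigma> @ [w] @ L3 m i \<sigma>), st (L2 m i \<rho>)))"

text \<open>The lift of \<^const>\<open>P_perm\<close> along \<^const>\<open>gamma\<close>, given pointwise for \<open>r \<in> Y (n + m - 1)\<close>.\<close>

definition P_tree :: "nat \<Rightarrow> nat \<Rightarrow> nat \<Rightarrow> btree \<Rightarrow> btree \<times> btree" where
  "P_tree n m i r =
     (THE p. p \<in> Y n \<times> Y m \<and> map_prod gamma gamma p = P_perm n m i (gamma r))"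

end

theory Submission
  imports Defs
begin

text \<open>The formula is Moebius inversion along an adjunction. For \<open>P_tree n m i r = (x, y)\<close> the grafting
satisfies \<open>tamari (graft_at i s t) r\<close> iff \<open>tamari s x\<close> and \<open>tamari t y\<close>, so \<open>P\<^sub>i\<close> is right adjoint to
the grafting \<open>B\<^sub>i\<close> for the Tamari orders (lemma \<open>P_tree_adjoint\<close>). Since \<open>F s\<close> is the sum of the \<open>M t\<close>
over all \<open>t\<close> above \<open>s\<close> (lemma \<open>F_eq_sum_M\<close>), expanding both factors of the left-hand side gives the
sum of \<open>\<mu>(s, s') \<mu>(t, t') M r\<close> over all \<open>s'\<close> above \<open>s\<close>, \<open>t'\<close> above \<open>t\<close> and \<open>r\<close> above
\<open>graft_at i s' t'\<close>. By the adjunction the last condition says that \<open>s'\<close> is below \<open>x\<close> and \<open>t'\<close> is below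
\<open>y\<close>, so the coefficient of \<open>M r\<close> is the product of the sum of \<open>\<mu>(s, s')\<close> over the interval \<open>[s, x]\<close>
and the sum of \<open>\<mu>(t, t')\<close> over \<open>[t, y]\<close>. This is 1 if \<open>(s, t) = P\<^sub>i(r)\<close> and 0 otherwise.

The adjunction is proved in coordinates. Number the nodes of a tree from 0 in in-order, so that the
positions of \<open>gamma t\<close> are the nodes of \<open>t\<close>, and consider the relation \<open>in_left t p q\<close>: node \<open>p\<close> lies in
the left subtree of node \<open>q\<close>. Four facts make this relation a faithful encoding.

  \<^item> The Tamari order is reverse inclusion of these relations (lemma \<open>tamari_iff_in_left\<close>).
  \<^item> The relations that occur are the transitive subrelations of \<open><\<close> that contain \<open>(k, q)\<close> whenever they
    contain \<open>(p, q)\<close> and \<open>p < k < q\<close> (lemma \<open>ex_btree_in_left\<close>).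
  \<^item> For \<open>p < q\<close> the entries of \<open>gamma t\<close> at \<open>p\<close> and \<open>q\<close> are in increasing order iff \<open>in_left t p q\<close>
    (lemma \<open>gamma_nth_less\<close>).
  \<^item> In \<open>graft_at i s t\<close> the nodes of \<open>t\<close> form a block of consecutive positions in place of the
    \<open>i\<close>-th node of \<open>s\<close>. Inside the block the relation is that of \<open>t\<close>; elsewhere it is that of \<open>s\<close>
    after contraction of the block to one point, up to a condition on pairs that enter the block
    from the left (lemma \<open>in_left_graft_at\<close>).

Hence \<open>graft_at i s t\<close> is below \<open>r\<close> iff the relation of \<open>t\<close> contains the restriction of the relation of
\<open>r\<close> to the block and the relation of \<open>s\<close> contains the relation that \<open>r\<close> induces after contraction. The
smallest relations of trees with these two properties define \<open>y\<close> and \<open>x\<close>: the restriction is already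
one, and for the contraction it suffices to close under paths through the contracted point (lemma
\<open>graft_at_tamari_iff\<close>). Reading the permutation \<open>B\<rho>\<close> as an order relation on positions shows that the
definition of \<open>P\<^sub>i\<close> through permutations yields exactly these two trees (lemma \<open>P_tree_eq\<close>).\<close>

section \<open>The left-subtree relation of a tree\<close>

text \<open>Nodes are numbered from 0 in in-order, so the root of \<open>Node l r\<close> is node \<open>size l\<close>.\<close>
fun in_left :: "btree \<Rightarrow> nat \<Rightarrow> nat \<Rightarrow> bool" where
  "in_left Leaf p q = False"
| "in_left (Node l r) p q =
     (if q < size l then in_left l p q
      else if q = size l then p < q
      else size l < p \<and> in_left r (p - Suc (size l)) (q - Suc (size l)))"

lemma in_left_less: "in_left t p q \<Longrightarrow> p < q"
proof (induction t p q rule: in_left.induct)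
  case (2 l r p q)
  then show ?case by (cases q "size l" rule: linorder_cases) auto
qed simp

lemma in_left_size: "in_left t p q \<Longrightarrow> q < size t"
proof (induction t p q rule: in_left.induct)
  case (2 l r p q)
  then show ?case by (cases q "size l" rule: linorder_cases) auto
qed simp

lemma in_left_interval: "in_left t p q \<Longrightarrow> p \<le> k \<Longrightarrow> k < q \<Longrightarrow> in_left t k q"
proof (induction t p q arbitrary: k rule: in_left.induct)
  case (2 l r p q)
  show ?case
  proof (cases q "size l" rule: linorder_cases)
    case less
    then show ?thesis using 2(1)[of k] "2.prems" by simp
  next
    case equal
    then show ?thesis using "2.prems" by simp
  next
    case greater
    then have "p - Suc (size l) \<le> k - Suc (size l)" "k - Suc (size l) < q - Suc (size l)" "size l < p"
      using "2.prems" by (auto simp: less_diff_iff)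
    then show ?thesis using 2(2)[of "k - Suc (size l)"] "2.prems" greater by simp
  qed
qed simp

lemma in_left_trans: "in_left t p q \<Longrightarrow> in_left t q k \<Longrightarrow> in_left t p k"
proof (induction t arbitrary: p q k)
  case (Node l r)
  have "p < q" "q < k"
    using Node.prems in_left_less by blast+
  show ?case
  proof (cases k "size l" rule: linorder_cases)
    case less
    then show ?thesis using Node.IH(1)[of p q k] Node.prems \<open>q < k\<close> by simp
  next
    case equal
    then show ?thesis using \<open>p < q\<close> \<open>q < k\<close> by simp
  next
    case greater
    then show ?thesis
      using Node.IH(2)[of "p - Suc (size l)" "q - Suc (size l)" "k - Suc (size l)"]
        Node.prems \<open>p < q\<close> by simp
  qed
qed simp

text \<open>The root has to be the last node \<open>k\<close> whose left subtree reaches position 0; interval closure then puts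
everything before \<open>k\<close> to its left, and transitivity prevents any later node from reaching across \<open>k\<close>.
The two subtrees come from the induction hypothesis on both sides of \<open>k\<close>.\<close>
lemma ex_btree_in_left:
  assumes "\<And>p q k. p < q \<Longrightarrow> q < k \<Longrightarrow> k < n \<Longrightarrow> R p q \<Longrightarrow> R q k \<Longrightarrow> R p k"
    and "\<And>p q k. p < k \<Longrightarrow> k < q \<Longrightarrow> q < n \<Longrightarrow> R p q \<Longrightarrow> R k q"
  shows "\<exists>t. size t = n \<and> (\<forall>p q. p < q \<longrightarrow> q < n \<longrightarrow> (in_left t p q \<longleftrightarrow> R p q))"
  using assms
proof (induction n arbitrary: R rule: less_induct)
  case (less n)
  show ?case
  proof (cases "n = 0")
    case True
    then show ?thesis by (intro exI[of _ Leaf]) auto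
  next
    case False
    define K where "K = insert 0 {q. 0 < q \<and> q < n \<and> R 0 q}"
    define k where "k = Max K"
    have finK: "finite K"
      unfolding K_def by auto
    have "k \<in> K"
      unfolding k_def using finK by (intro Max_in) (auto simp: K_def)
    then have "k < n" and k0: "k = 0 \<or> R 0 k"
      using False by (auto simp: K_def)
    have kmax: "\<not> R 0 q" if "k < q" "q < n" for q
    proof
      assume "R 0 q"
      with that have "q \<in> K" by (auto simp: K_def)
      then have "q \<le> k" unfolding k_def using finK by simp
      with that show False by simp
    qed
    have upto_k: "R p k" if "p < k" for p
      using k0 that less.prems(2)[of 0 p k] \<open>k < n\<close> by (cases "p = 0") auto
    \<comment> \<open>otherwise \<open>R 0 q\<close> would hold with \<open>q > k\<close>, against the maximality of \<open>k\<close>\<close>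
    have across: "\<not> R p q" if "p \<le> k" "k < q" "q < n" for p q
    proof
      assume "R p q"
      then have "R k q" using less.prems(2)[of p k q] that by (cases "p = k") auto
      then have "R 0 q" using less.prems(1)[of 0 k q] that k0 by (cases "k = 0") auto
      then show False using kmax that by blast
    qed
    have "\<exists>t. size t = k \<and> (\<forall>p q. p < q \<longrightarrow> q < k \<longrightarrow> (in_left t p q \<longleftrightarrow> R p q))"
    proof (rule less.IH[OF \<open>k < n\<close>])
      fix p q j assume "p < q" "q < j" "j < k" "R p q" "R q j"
      then show "R p j" using less.prems(1)[of p q j] \<open>k < n\<close> by simp
    next
      fix p q j assume "p < j" "j < q" "q < k" "R p q"
      then show "R j q" using less.prems(2)[of p j q] \<open>k < n\<close> by simp
    qed
    then obtain l where l: "size l = k" "\<And>p q. p < q \<Longrightarrow> q < k \<Longrightarrow> in_left l p q = R p q"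
      by blast
    have "\<exists>t. size t = n - Suc k \<and> (\<forall>p q. p < q \<longrightarrow> q < n - Suc k \<longrightarrow>
        (in_left t p q \<longleftrightarrow> R (p + Suc k) (q + Suc k)))"
    proof (rule less.IH)
      show "n - Suc k < n" using \<open>k < n\<close> by simp
    next
      fix p q j assume "p < q" "q < j" "j < n - Suc k"
        "R (p + Suc k) (q + Suc k)" "R (q + Suc k) (j + Suc k)"
      then show "R (p + Suc k) (j + Suc k)"
        using less.prems(1)[of "p + Suc k" "q + Suc k" "j + Suc k"] by simp
    next
      fix p q j assume "p < j" "j < q" "q < n - Suc k" "R (p + Suc k) (q + Suc k)"
      then show "R (j + Suc k) (q + Suc k)"
        using less.prems(2)[of "p + Suc k" "j + Suc k" "q + Suc k"] by simp
    qed
    then obtain r where r: "size r = n - Suc k"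
      "\<And>p q. p < q \<Longrightarrow> q < n - Suc k \<Longrightarrow> in_left r p q = R (p + Suc k) (q + Suc k)"
      by blast
    have "in_left (Node l r) p q = R p q" if "p < q" "q < n" for p q
    proof (cases "q \<le> k")
      case True
      then show ?thesis using that l upto_k by auto
    next
      case False
      then show ?thesis
        using that l(1) r(2)[of "p - Suc k" "q - Suc k"] across[of p q] by (cases "p \<le> k") auto
    qed
    moreover have "size (Node l r) = n" using l r \<open>k < n\<close> by simp
    ultimately show ?thesis by blast
  qed
qed

section \<open>The Tamari order as reverse inclusion\<close>

lemma rotation_in_left: "rotation s t \<Longrightarrow> in_left t p q \<Longrightarrow> in_left s p q"
proof (induction arbitrary: p q rule: rotation.induct)
  case (root a b c)
  then show ?case by (auto split: if_splits simp: diff_diff_left)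
next
  case (left l l' r)
  then show ?case using rotation_size[OF left.hyps] by (auto split: if_splits)
next
  case (right r r' l)
  then show ?case by (auto split: if_splits)
qed

lemma tamari_Node:
  "tamari l l' \<Longrightarrow> tamari r r' \<Longrightarrow> tamari (Node l r) (Node l' r')"
proof -
  have L: "tamari (Node l r) (Node l' r)" if "tamari l l'" for l l' r
    using that unfolding tamari_def
    by (induction rule: rtranclp_induct) (auto intro: rotation.left rtranclp.rtrancl_into_rtrancl)
  have R: "tamari (Node l r) (Node l r')" if "tamari r r'" for l r r'
    using that unfolding tamari_def
    by (induction rule: rtranclp_induct) (auto intro: rotation.right rtranclp.rtrancl_into_rtrancl)
  show "tamari l l' \<Longrightarrow> tamari r r' \<Longrightarrow> tamari (Node l r) (Node l' r')"
    using L R tamari_trans by blast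
qed

text \<open>If the left subtree of \<open>k\<close> contains everything before \<open>k\<close>, then \<open>k\<close> lies on the left branch, and
rotating it upwards along this branch makes it the root. The rotations destroy only those relations
that reach across \<open>k\<close>, which no tree with root \<open>k\<close> has. This is what makes it possible to match the
root of a larger tree by upward moves.\<close>
lemma rotate_to_root:
  assumes "k < size s" and "\<And>p. p < k \<Longrightarrow> in_left s p k"
  shows "\<exists>a b. size a = k \<and> tamari s (Node a b) \<and>
    (\<forall>p q. in_left s p q \<longrightarrow> \<not> (p \<le> k \<and> k < q) \<longrightarrow> in_left (Node a b) p q)"
  using assms
proof (induction s)
  case (Node l r)
  have "k \<le> size l"
    using Node.prems(2)[of 0] by (cases "size l < k") auto
  show ?case
  proof (cases "k = size l")
    case True
    then show ?thesis using tamari_refl by blast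
  next
    case False
    with \<open>k \<le> size l\<close> have k: "k < size l" by simp
    have "\<And>p. p < k \<Longrightarrow> in_left l p k"
      using Node.prems(2) k by auto
    \<comment> \<open>\<open>k\<close> is first rotated to the root of \<open>l\<close>; one more rotation lifts it above the root\<close>
    from Node.IH(1)[OF k this] obtain a b where ab: "size a = k" "tamari l (Node a b)"
      "\<And>p q. in_left l p q \<Longrightarrow> \<not> (p \<le> k \<and> k < q) \<Longrightarrow> in_left (Node a b) p q" by blast
    have "tamari (Node l r) (Node (Node a b) r)"
      using ab(2) tamari_refl by (rule tamari_Node)
    moreover have "tamari (Node (Node a b) r) (Node a (Node b r))"
      unfolding tamari_def using rotation.root by blast
    ultimately have *: "tamari (Node l r) (Node a (Node b r))"
      by (rule tamari_trans)
    have sz: "size l = Suc (k + size b)"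
      using tamari_size[OF ab(2)] ab(1) by simp
    have "in_left (Node a (Node b r)) p q"
      if pq: "in_left (Node l r) p q" and out: "\<not> (p \<le> k \<and> k < q)" for p q
    proof -
      consider "q < size l" "in_left l p q" | "q = size l" "p < q"
        | "size l < q" "size l < p" "in_left r (p - Suc (size l)) (q - Suc (size l))"
        using pq by (auto split: if_splits)
      then show ?thesis
      proof cases
        case 1
        then show ?thesis using ab(3)[OF 1(2) out] ab(1) sz out by (auto split: if_splits)
      next
        case 2
        then show ?thesis using ab(1) sz out by auto
      next
        case 3
        then show ?thesis using ab(1) sz out by (auto simp: diff_diff_left)
      qed
    qed
    then show ?thesis using * ab(1) by blast
  qed
qed simp

text \<open>For the backward direction the root of \<open>t\<close> is first rotated to the root of \<open>s\<close>, which keeps the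
relation of \<open>s\<close> above that of \<open>t\<close>; then the two pairs of subtrees are compared by induction.\<close>
lemma tamari_iff_in_left:
  "tamari s t \<longleftrightarrow> size s = size t \<and> (\<forall>p q. in_left t p q \<longrightarrow> in_left s p q)"
proof
  assume "tamari s t"
  then show "size s = size t \<and> (\<forall>p q. in_left t p q \<longrightarrow> in_left s p q)"
    unfolding tamari_def
    by (induction rule: rtranclp_induct) (auto simp: rotation_in_left rotation_size)
next
  assume "size s = size t \<and> (\<forall>p q. in_left t p q \<longrightarrow> in_left s p q)"
  then show "tamari s t"
  proof (induction t arbitrary: s)
    case Leaf
    then show ?case by (cases s) (auto simp: tamari_refl)
  next
    case (Node t1 t2)
    define k where "k = size t1"
    have sub: "\<And>p q. in_left (Node t1 t2) p q \<Longrightarrow> in_left s p q"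
      and sz: "size s = size (Node t1 t2)"
      using Node.prems by blast+
    obtain a b where ab: "size a = k" "tamari s (Node a b)"
      "\<And>p q. in_left s p q \<Longrightarrow> \<not> (p \<le> k \<and> k < q) \<Longrightarrow> in_left (Node a b) p q"
      using rotate_to_root[of k s] sub[of _ k] sz by (simp add: k_def del: in_left.simps) (metis in_left.simps(2) less_irrefl)
    have sub': "in_left (Node a b) p q" if "in_left (Node t1 t2) p q" for p q
      using ab(3)[OF sub[OF that]] that by (auto simp: k_def split: if_splits)
    have "tamari a t1"
    proof (rule Node.IH(1), intro conjI allI impI)
      show "size a = size t1" using ab(1) k_def by simp
      fix p q assume "in_left t1 p q"
      then show "in_left a p q"
        using sub'[of p q] in_left_size[of t1 p q] ab(1) by (auto simp: k_def)
    qed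
    moreover have "tamari b t2"
    proof (rule Node.IH(2), intro conjI allI impI)
      show "size b = size t2" using tamari_size[OF ab(2)] sz ab(1) k_def by simp
      fix p q assume "in_left t2 p q"
      then show "in_left b p q"
        using sub'[of "p + Suc k" "q + Suc k"] ab(1) by (auto simp: k_def)
    qed
    ultimately show ?case
      using ab(2) tamari_Node tamari_trans by blast
  qed
qed

lemma btree_eqI_in_left:
  "size s = size t \<Longrightarrow> (\<And>p q. p < q \<Longrightarrow> q < size t \<Longrightarrow> in_left s p q = in_left t p q) \<Longrightarrow> s = t"
  by (rule tamari_antisym) (metis tamari_iff_in_left in_left_less in_left_size)+

section \<open>The left-subtree relation of a grafting\<close>

lemma size_over [simp]: "size (over s t) = size s + size t"
  by (induction s t rule: over.induct) auto

lemma size_under [simp]: "size (under s t) = size s + size t"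
  by (induction s t rule: under.induct) auto

text \<open>Node 0 of \<open>t\<close> ends the leftmost branch, so \<open>s\<close> becomes its left subtree; the other nodes that acquire
\<open>s\<close> on their left are those having node 0 of \<open>t\<close> on their left.\<close>
lemma in_left_over:
  "p < q \<Longrightarrow> in_left (over s t) p q \<longleftrightarrow>
    (if q < size s then in_left s p q
     else if size s \<le> p then in_left t (p - size s) (q - size s)
     else q < size s + size t \<and> (q = size s \<or> in_left t 0 (q - size s)))"
proof (induction s t arbitrary: p q rule: over.induct)
  case (1 s)
  then show ?case using in_left_size[of s p q] by auto
next
  case (2 s t1 t2)
  show ?case
  proof (cases q "size s + size t1" rule: linorder_cases)
    case less
    then have "q < size s \<or> q - size s < size t1" by linarith
    with less show ?thesis using 2 by auto
  next
    case equal
    then show ?thesis using 2 by auto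
  next
    case greater
    define q' where "q' = q - Suc (size s + size t1)"
    have q: "q = q' + Suc (size s + size t1)" using greater by (simp add: q'_def)
    show ?thesis
      using in_left_size[of t2 "p - Suc (size s + size t1)" q']
      by (auto simp: q diff_diff_left)
  qed
qed

lemma in_left_under:
  "in_left (under s t) p q \<longleftrightarrow>
    (if q < size s then in_left s p q
     else size s \<le> p \<and> in_left t (p - size s) (q - size s))"
  by (induction s arbitrary: p q) (auto simp: diff_diff_left)

lemma size_graft_at:
  "1 \<le> i \<Longrightarrow> i \<le> size s \<Longrightarrow> t \<noteq> Leaf \<Longrightarrow> size (graft_at i s t) = size s + size t - 1"
proof (induction i s t rule: graft_at.induct)
  case (1 i s1 s2 t1 t2)
  then show ?case by (auto simp: Let_def)
qed auto

text \<open>The order-preserving map that contracts the block of \<open>m\<close> positions starting at \<open>b\<close> to the single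
position \<open>b\<close>.\<close>
definition collapse :: "nat \<Rightarrow> nat \<Rightarrow> nat \<Rightarrow> nat" where
  "collapse b m p = (if p < b then p else if p < b + m then b else p + 1 - m)"

lemma collapse_less: "p < b \<Longrightarrow> collapse b m p = p"
  and collapse_block: "b \<le> p \<Longrightarrow> p < b + m \<Longrightarrow> collapse b m p = b"
  and collapse_ge: "b + m \<le> p \<Longrightarrow> collapse b m p = p + 1 - m"
  by (simp_all add: collapse_def)

lemma collapse_add: "collapse (b + d) m (p + d) = (if p < b \<or> 0 < m then collapse b m p + d else p + d + 1)"
  by (auto simp: collapse_def)

text \<open>The grafting replaces node \<open>b\<close> of \<open>s\<close> by the block of the nodes of \<open>t\<close>. The left subtree of node \<open>b\<close>
hangs below node 0 of \<open>t\<close>, so a node of the block sees it exactly if it is node 0 or has node 0 on its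
left; this is the last conjunct. Nodes after the block see either all of it or nothing, as
they did with node \<open>b\<close>.\<close>
lemma in_left_graft_at:
  assumes "b < size s" and "t \<noteq> Leaf" and "p < q"
  shows "in_left (graft_at (Suc b) s t) p q \<longleftrightarrow>
    (if b \<le> p \<and> q < b + size t then in_left t (p - b) (q - b)
     else in_left s (collapse b (size t) p) (collapse b (size t) q) \<and>
       (b < q \<and> q < b + size t \<longrightarrow> in_left t 0 (q - b)))"
  using assms
proof (induction s arbitrary: b p q)
  case (Node s1 s2)
  obtain t1 t2 where t: "t = Node t1 t2"
    using Node.prems by (cases t) auto
  define m where "m = size t"
  have m: "m = size t1 + size t2 + 1" by (simp add: m_def t)
  consider (right) "size s1 < b" | (root) "size s1 = b" | (left) "b < size s1" by linarith
  then show ?case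
  proof cases
    case right
    define d where "d = Suc (size s1)"
    define c where "c = b - d"
    have b: "b = c + d" using right by (simp add: c_def d_def)
    have g: "graft_at (Suc b) (Node s1 s2) t = Node s1 (graft_at (Suc c) s2 t)"
      using b by (simp add: t Suc_diff_le d_def)
    show ?thesis
    proof (cases "d \<le> p")
      case True
      define p' q' where "p' = p - d" and "q' = q - d"
      have pq: "p = p' + d" "q = q' + d" using True \<open>p < q\<close> by (auto simp: p'_def q'_def)
      have shift: "in_left (Node s1 x) (y + d) (z + d) = in_left x y z" for x y z
        by (simp add: d_def)
      have IH: "in_left (graft_at (Suc c) s2 t) p' q' \<longleftrightarrow>
        (if c \<le> p' \<and> q' < c + m then in_left t (p' - c) (q' - c)
         else in_left s2 (collapse c m p') (collapse c m q') \<and>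
           (c < q' \<and> q' < c + m \<longrightarrow> in_left t 0 (q' - c)))"
        using Node.IH(2)[of c p' q'] Node.prems pq b unfolding m_def by (simp add: d_def)
      have "0 < m" by (simp add: m)
      show ?thesis
        unfolding g m_def[symmetric] unfolding b pq collapse_add shift
        using \<open>0 < m\<close> by (simp add: IH shift del: in_left.simps)
    next
      case False
      then have p: "p < b" "collapse b m p = p" using b by (auto simp: collapse_def)
      have q: "collapse b m q = q \<and> q < b \<or> b \<le> collapse b m q \<and> b \<le> q"
        using m by (auto simp: collapse_def)
      show ?thesis
        unfolding g m_def[symmetric] using q p False right by (auto simp: d_def)
    qed
  next
    case root
    have g: "graft_at (Suc b) (Node s1 s2) t = Node (over s1 t1) (under t2 s2)"
      using root by (simp add: t)
    have sz: "size (over s1 t1) = b + size t1" using root by simp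
    have over: "in_left (over s1 t1) p q \<longleftrightarrow>
      (if q < b then in_left s1 p q
       else if b \<le> p then in_left t1 (p - b) (q - b)
       else q < b + size t1 \<and> (q = b \<or> in_left t1 0 (q - b)))"
      using in_left_over[OF \<open>p < q\<close>, of s1 t1] root by simp
    \<comment> \<open>the root of the grafting is the root of \<open>t\<close>, at position \<open>b + size t1\<close>\<close>
    consider "q < b" | "b \<le> q" "q < b + size t1" | "q = b + size t1"
      | "b + size t1 < q" "q < b + m" | "b + m \<le> q" by linarith
    then show ?thesis
    proof cases
      case 1
      then show ?thesis
        unfolding g m_def[symmetric] using \<open>p < q\<close> root by (simp add: collapse_less over)
    next
      case 2
      then show ?thesis
        unfolding g m_def[symmetric] using \<open>p < q\<close> root m
        by (cases "p < b") (auto simp: collapse_less collapse_block over t)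
    next
      case 3
      then show ?thesis
        unfolding g m_def[symmetric] using \<open>p < q\<close> root m
        by (cases "p < b") (auto simp: collapse_less collapse_block t)
    next
      case 4
      define q' where "q' = q - Suc (b + size t1)"
      have q: "q = q' + Suc (b + size t1)" "q' < size t2" using 4 m by (auto simp: q'_def)
      have lhs: "in_left (graft_at (Suc b) (Node s1 s2) t) p q \<longleftrightarrow>
         b + size t1 < p \<and> in_left t2 (p - Suc (b + size t1)) q'"
        unfolding g using q sz by (simp add: in_left_under)
      show ?thesis
      proof (cases "p < b")
        case True
        then show ?thesis
          unfolding lhs m_def[symmetric] using q m root by (simp add: collapse_less collapse_block t)
      next
        case False
        then have "in_left t (p - b) (q - b) \<longleftrightarrow>
          b + size t1 < p \<and> in_left t2 (p - Suc (b + size t1)) q'"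
          using q by (auto simp: t diff_diff_left less_diff_conv2 algebra_simps)
        then show ?thesis
          unfolding lhs m_def[symmetric] using 4 False by simp
      qed
    next
      case 5
      define q' where "q' = q - (b + m)"
      have q: "q = q' + b + m" using 5 by (auto simp: q'_def)
      have lhs: "in_left (graft_at (Suc b) (Node s1 s2) t) p q \<longleftrightarrow> b + m \<le> p \<and> in_left s2 (p - (b + m)) q'"
        unfolding g using q sz m by (auto simp: in_left_under diff_diff_left algebra_simps)
      \<comment> \<open>\<open>q\<close> lies in the right subtree of \<open>s\<close>, which hangs at the end of the right branch of \<open>t2\<close>\<close>
      have cq: "collapse b m q = q' + Suc b" using q m by (simp add: collapse_ge)
      show ?thesis
      proof (cases "b + m \<le> p")
        case True
        define p' where "p' = p - (b + m)"
        have p: "p = p' + b + m" using True by (simp add: p'_def)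
        have cp: "collapse b m p = p' + Suc b" using p m by (simp add: collapse_ge)
        show ?thesis unfolding lhs m_def[symmetric] cq cp p'_def[symmetric] using True q root by simp
      next
        case False
        then have "collapse b m p \<le> b" by (simp add: collapse_def)
        then show ?thesis unfolding lhs m_def[symmetric] cq using False q root by simp
      qed
    qed
  next
    case left
    have g: "graft_at (Suc b) (Node s1 s2) t = Node (graft_at (Suc b) s1 t) s2"
      using left by (simp add: t)
    have sz: "size (graft_at (Suc b) s1 t) = size s1 + m - 1"
      using size_graft_at[of "Suc b" s1 t] left by (simp add: t m)
    have IH: "in_left (graft_at (Suc b) s1 t) p q \<longleftrightarrow>
      (if b \<le> p \<and> q < b + m then in_left t (p - b) (q - b)
       else in_left s1 (collapse b m p) (collapse b m q) \<and>
         (b < q \<and> q < b + m \<longrightarrow> in_left t 0 (q - b)))"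
      using Node.IH(1)[of b p q] Node.prems left unfolding m_def by simp
    show ?thesis
    proof (cases "q < b + m")
      case True
      then have "q < size s1 + m - 1" "collapse b m q < size s1"
        using left m by (auto simp: collapse_def)
      then show ?thesis
        unfolding g m_def[symmetric] using IH sz by simp
    next
      case False
      then have cq: "collapse b m q = q + 1 - m" by (simp add: collapse_ge)
      consider "q < size s1 + m - 1" | "q = size s1 + m - 1" | "size s1 + m - 1 < q" by linarith
      then show ?thesis
      proof cases
        case 1
        then have "collapse b m q < size s1" using cq m False by linarith
        then show ?thesis
          unfolding g m_def[symmetric] using IH sz 1 by simp
      next
        case 2
        then have c: "collapse b m q = size s1" using cq m by simp
        have "collapse b m p < size s1" using \<open>p < q\<close> 2 left m by (auto simp: collapse_def)
        then show ?thesis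
          unfolding g m_def[symmetric] using 2 sz c \<open>p < q\<close> False by simp
      next
        case 3
        define q' where "q' = q - (size s1 + m)"
        have q: "q = q' + size s1 + m" using 3 m by (simp add: q'_def)
        have cq': "collapse b m q = q' + Suc (size s1)" using cq q m by simp
        have lhs: "in_left (graft_at (Suc b) (Node s1 s2) t) p q \<longleftrightarrow>
           size s1 + m \<le> p \<and> in_left s2 (p - (size s1 + m)) q'"
          unfolding g using q sz m by (auto simp: diff_diff_left algebra_simps)
        show ?thesis
        proof (cases "size s1 + m \<le> p")
          case True
          define p' where "p' = p - (size s1 + m)"
          have p: "p = p' + size s1 + m" using True by (simp add: p'_def)
          have cp: "collapse b m p = p' + Suc (size s1)"
            using p m left by (simp add: collapse_ge)
          show ?thesis unfolding lhs m_def[symmetric] cq' cp p'_def[symmetric] using True q left by simp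
        next
          case f: False
          then have "collapse b m p \<le> size s1" using left m by (auto simp: collapse_def)
          then show ?thesis unfolding lhs m_def[symmetric] cq' using f q left by simp
        qed
      qed
    qed
  qed
qed simp

section \<open>The adjunction between grafting and its projections\<close>

lemma collapse_mono: "p \<le> q \<Longrightarrow> collapse b m p \<le> collapse b m q"
  by (auto simp: collapse_def)

lemma collapse_surj: "0 < m \<Longrightarrow> \<exists>p'. collapse b m p' = p"
  by (rule exI[of _ "if p < b then p else p + m - 1"]) (auto simp: collapse_def)

lemma collapse_inj: "collapse b m p = collapse b m q \<Longrightarrow> collapse b m p \<noteq> b \<Longrightarrow> p = q"
  by (auto simp: collapse_def split: if_splits)

text \<open>The image of the relation of \<open>r\<close> under the contraction. It need not be transitive at \<open>b\<close>, because two
pairs that meet at \<open>b\<close> may come from different nodes of the block.\<close>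
definition contracted :: "nat \<Rightarrow> nat \<Rightarrow> btree \<Rightarrow> nat \<Rightarrow> nat \<Rightarrow> bool" where
  "contracted b m r p q \<longleftrightarrow> (\<exists>p' q'. in_left r p' q' \<and> collapse b m p' = p \<and> collapse b m q' = q)"

lemma contracted_le: "contracted b m r p q \<Longrightarrow> p \<le> q"
  unfolding contracted_def using collapse_mono in_left_less by (metis less_imp_le)

lemma contracted_interval:
  assumes "contracted b m r p q" "p < k" "k < q" "0 < m"
  shows "contracted b m r k q"
proof -
  obtain p' q' where pq: "in_left r p' q'" "collapse b m p' = p" "collapse b m q' = q"
    using assms(1) by (auto simp: contracted_def)
  obtain k' where k: "collapse b m k' = k" using collapse_surj[OF \<open>0 < m\<close>] by blast
  have "p' < k'" "k' < q'"
    using collapse_mono[of k' p' b m] collapse_mono[of q' k' b m] pq k assms by force+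
  then have "in_left r k' q'" using in_left_interval[OF pq(1)] by simp
  then show ?thesis using pq k by (auto simp: contracted_def)
qed

text \<open>Away from \<open>b\<close> the contraction is injective, so pairs that meet at \<open>q\<close> lift to pairs of \<open>r\<close> that meet.\<close>
lemma contracted_trans:
  assumes "contracted b m r p q" "contracted b m r q k" "q \<noteq> b"
  shows "contracted b m r p k"
  using assms collapse_inj in_left_trans unfolding contracted_def by metis

text \<open>Transitivity can fail only at \<open>b\<close>, so closing under paths of length two through \<open>b\<close> is enough.\<close>
lemma ex_btree_contraction:
  assumes "0 < m"
  shows "\<exists>x. size x = n \<and> (\<forall>p q. p < q \<longrightarrow> q < n \<longrightarrow>
    (in_left x p q \<longleftrightarrow> contracted b m r p q \<or> contracted b m r p b \<and> contracted b m r b q))"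
proof (rule ex_btree_in_left)
  let ?C = "contracted b m r"
  fix p q k
  assume "?C p q \<or> ?C p b \<and> ?C b q" "?C q k \<or> ?C q b \<and> ?C b k"
  then show "?C p k \<or> ?C p b \<and> ?C b k"
    using contracted_trans[of b m r p q k] contracted_trans[of b m r p q b]
      contracted_trans[of b m r b q k] by blast
next
  let ?C = "contracted b m r"
  fix p q k
  assume pkq: "p < k" "k < q" and "?C p q \<or> ?C p b \<and> ?C b q"
  then consider "?C p q" | "?C p b" "?C b q" by blast
  then show "?C k q \<or> ?C k b \<and> ?C b q"
  proof cases
    case 1
    then show ?thesis using contracted_interval pkq assms by blast
  next
    case 2
    then show ?thesis
      using contracted_interval[OF 2(1) \<open>p < k\<close>] contracted_interval[OF 2(2) _ \<open>k < q\<close>] assms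
      by (cases k b rule: linorder_cases) auto
  qed
qed

lemma ex_btree_restriction:
  "\<exists>y. size y = m \<and> (\<forall>p q. p < q \<longrightarrow> q < m \<longrightarrow> (in_left y p q \<longleftrightarrow> in_left r (p + b) (q + b)))"
  by (rule ex_btree_in_left) (auto intro: in_left_trans in_left_interval)

text \<open>The adjunction in coordinates: \<open>x\<close> and \<open>y\<close> are described by the smallest relations that the pairs of \<open>r\<close>
force upon \<open>s\<close> and \<open>t\<close> when the grafting lies below \<open>r\<close>. A pair inside the block concerns only \<open>t\<close>, and
every other pair concerns \<open>s\<close>. A pair \<open>(p, q)\<close> that enters the block from the left also requires
that node 0 of \<open>t\<close> be \<open>q\<close> or be related to \<open>q\<close>; this is automatic since the relation of \<open>r\<close> is closed under passing
from \<open>(p, q)\<close> to \<open>(b, q)\<close>.\<close>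
lemma graft_at_tamari_iff:
  assumes sz: "b < size s" "size r = size s + size t - 1" "t \<noteq> Leaf"
    and x: "size x = size s" "\<And>p q. p < q \<Longrightarrow> q < size s \<Longrightarrow> in_left x p q \<longleftrightarrow>
        contracted b (size t) r p q \<or> contracted b (size t) r p b \<and> contracted b (size t) r b q"
    and y: "size y = size t" "\<And>p q. p < q \<Longrightarrow> q < size t \<Longrightarrow> in_left y p q \<longleftrightarrow> in_left r (p + b) (q + b)"
  shows "tamari (graft_at (Suc b) s t) r \<longleftrightarrow> tamari s x \<and> tamari t y"
proof -
  define m where "m = size t"
  have "0 < m" using sz by (cases t) (auto simp: m_def)
  let ?C = "contracted b m r" and ?g = "graft_at (Suc b) s t"
  have graft: "p < q \<Longrightarrow> in_left ?g p q \<longleftrightarrow>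
    (if b \<le> p \<and> q < b + m then in_left t (p - b) (q - b)
     else in_left s (collapse b m p) (collapse b m q) \<and>
       (b < q \<and> q < b + m \<longrightarrow> in_left t 0 (q - b)))" for p q
    unfolding m_def using in_left_graft_at sz by blast
  have graft_out: "in_left ?g p q \<longleftrightarrow> in_left s (collapse b m p) (collapse b m q) \<and>
       (b < q \<and> q < b + m \<longrightarrow> in_left t 0 (q - b))"
    if "p < q" "\<not> (b \<le> p \<and> q < b + m)" for p q
    using graft[OF that(1)] by (simp only: that if_False)
  have size_g: "size ?g = size r" using size_graft_at[of "Suc b" s t] sz by simp
  show ?thesis
  proof
    assume "tamari ?g r"
    then have sub: "in_left r p q \<Longrightarrow> in_left ?g p q" for p q
      by (simp add: tamari_iff_in_left)
    have C_s: "in_left s p q" if "?C p q" "p \<noteq> q" for p q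
    proof -
      obtain p' q' where pq: "in_left r p' q'" "collapse b m p' = p" "collapse b m q' = q"
        using \<open>?C p q\<close> by (auto simp: contracted_def)
      have "p' < q'" using in_left_less[OF pq(1)] .
      have "\<not> (b \<le> p' \<and> q' < b + m)"
        using \<open>p \<noteq> q\<close> pq \<open>p' < q'\<close> by (auto simp: collapse_block)
      from graft_out[OF \<open>p' < q'\<close> this] show ?thesis using sub[OF pq(1)] pq by simp
    qed
    have "in_left s p q" if "in_left x p q" for p q
    proof -
      have "p < q" "q < size s" using in_left_less in_left_size that x(1) by metis+
      then have "?C p q \<or> ?C p b \<and> ?C b q" using x(2) that by (simp add: m_def)
      then show ?thesis
        using C_s[of p q] C_s[of p b] C_s[of b q] in_left_trans[of s p b q] \<open>p < q\<close> by blast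
    qed
    moreover have "in_left t p q" if "in_left y p q" for p q
    proof -
      have "p < q" "q < m" using in_left_less in_left_size that y(1) m_def by metis+
      then have "in_left r (p + b) (q + b)" using y(2) that by (simp add: m_def)
      from sub[OF this] show ?thesis
        using graft[of "p + b" "q + b"] \<open>p < q\<close> \<open>q < m\<close> by simp
    qed
    ultimately show "tamari s x \<and> tamari t y"
      using x(1) y(1) by (simp add: tamari_iff_in_left)
  next
    assume "tamari s x \<and> tamari t y"
    then have sx: "in_left x p q \<Longrightarrow> in_left s p q" and ty: "in_left y p q \<Longrightarrow> in_left t p q" for p q
      by (simp_all add: tamari_iff_in_left)
    have in_block: "in_left t (p - b) (q - b)" if "in_left r p q" "b \<le> p" "q < b + m" for p q
      using ty[of "p - b" "q - b"] y(2)[of "p - b" "q - b"] in_left_less[OF that(1)] that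
      by (simp add: m_def)
    have "in_left ?g p q" if rpq: "in_left r p q" for p q
    proof (cases "b \<le> p \<and> q < b + m")
      case True
      then show ?thesis using graft[OF in_left_less[OF rpq]] in_block[OF rpq] by simp
    next
      case False
      have "p < q" "q < size r" using in_left_less in_left_size rpq by blast+
      have C: "?C (collapse b m p) (collapse b m q)" using rpq by (auto simp: contracted_def)
      have "collapse b m p < collapse b m q"
        using False \<open>p < q\<close> by (auto simp: collapse_def)
      moreover have "collapse b m q < size s"
        using \<open>q < size r\<close> sz \<open>0 < m\<close> by (auto simp: collapse_def m_def)
      ultimately have "in_left s (collapse b m p) (collapse b m q)"
        using x(2) C sx by (simp add: m_def)
      moreover have "in_left t 0 (q - b)" if "b < q" "q < b + m"
      proof -
        have "in_left r b q" using in_left_interval[OF rpq] False that by auto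
        then show ?thesis using in_block[of b q] that by simp
      qed
      ultimately show ?thesis using graft_out[OF \<open>p < q\<close> False] by blast
    qed
    then show "tamari ?g r" using size_g by (simp add: tamari_iff_in_left)
  qed
qed

section \<open>Standardization and the permutation of a tree\<close>

definition rank :: "nat set \<Rightarrow> nat \<Rightarrow> nat" where
  "rank A x = card {y \<in> A. y < x}"

lemma rank_strict_mono: "finite A \<Longrightarrow> x \<in> A \<Longrightarrow> x < y \<Longrightarrow> rank A x < rank A y"
  unfolding rank_def by (rule psubset_card_mono) auto

lemma rank_less_iff: "finite A \<Longrightarrow> x \<in> A \<Longrightarrow> y \<in> A \<Longrightarrow> rank A x < rank A y \<longleftrightarrow> x < y"
  using rank_strict_mono by (metis linorder_neqE_nat less_asym less_irrefl)

lemma rank_less_card: "finite A \<Longrightarrow> x \<in> A \<Longrightarrow> rank A x < card A"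
  unfolding rank_def by (rule psubset_card_mono) auto

lemma inj_on_rank: "finite A \<Longrightarrow> inj_on (rank A) A"
  by (rule inj_onI) (metis rank_less_iff linorder_neqE_nat less_irrefl)

lemma rank_image: "finite A \<Longrightarrow> rank A ` A = {..<card A}"
  by (rule card_subset_eq) (auto simp: rank_less_card card_image inj_on_rank)

definition same_order :: "nat list \<Rightarrow> nat list \<Rightarrow> bool" where
  "same_order a b \<longleftrightarrow> length a = length b \<and>
     (\<forall>p<length a. \<forall>q<length a. a ! p < a ! q \<longleftrightarrow> b ! p < b ! q)"

lemma same_order_sym: "same_order a b \<Longrightarrow> same_order b a"
  by (auto simp: same_order_def)

lemma same_order_trans: "same_order a b \<Longrightarrow> same_order b c \<Longrightarrow> same_order a c"
  by (auto simp: same_order_def)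

lemma same_orderI:
  assumes "distinct a" "distinct b" "length a = length b"
    and "\<And>p q. p < q \<Longrightarrow> q < length b \<Longrightarrow> a ! p < a ! q \<longleftrightarrow> b ! p < b ! q"
  shows "same_order a b"
  unfolding same_order_def
proof (intro conjI allI impI)
  fix p q assume pq: "p < length a" "q < length a"
  show "a ! p < a ! q \<longleftrightarrow> b ! p < b ! q"
  proof (cases p q rule: linorder_cases)
    case less
    then show ?thesis using assms pq by simp
  next
    case greater
    have "a ! p \<noteq> a ! q" "b ! p \<noteq> b ! q" using greater assms pq by (simp_all add: nth_eq_iff_index_eq)
    then show ?thesis using greater assms(3) assms(4)[of q p] pq by linarith
  qed simp
qed fact

lemma same_order_map:
  "strict_mono_on (set a) f \<Longrightarrow> same_order (map f a) a"
  by (auto simp: same_order_def strict_mono_on_less)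

lemma rank_set_nth:
  "distinct a \<Longrightarrow> rank (set a) x = card {q. q < length a \<and> a ! q < x}"
proof -
  assume "distinct a"
  then have "inj_on ((!) a) {q. q < length a \<and> a ! q < x}"
    by (auto simp: inj_on_def nth_eq_iff_index_eq)
  moreover have "{y \<in> set a. y < x} = (!) a ` {q. q < length a \<and> a ! q < x}"
    by (auto simp: in_set_conv_nth)
  ultimately show ?thesis by (simp add: rank_def card_image)
qed

lemma same_order_set_eq:
  assumes "distinct a" "distinct b" "same_order a b" "set a = set b"
  shows "a = b"
proof (rule nth_equalityI)
  show len: "length a = length b" using assms(3) by (simp add: same_order_def)
  fix p assume p: "p < length a"
  have "{q. q < length a \<and> a ! q < a ! p} = {q. q < length b \<and> b ! q < b ! p}"
    using assms(3) p by (auto simp: same_order_def)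
  then have "rank (set a) (a ! p) = rank (set a) (b ! p)"
    using rank_set_nth[OF assms(1)] rank_set_nth[OF assms(2)] assms(4) by simp
  moreover have "a ! p \<in> set a" using p by simp
  moreover have "b ! p \<in> set a" unfolding assms(4) using p len by simp
  ultimately show "a ! p = b ! p" using inj_on_rank[of "set a"] by (simp add: inj_on_eq_iff)
qed

lemma perms_iff: "\<sigma> \<in> perms n \<longleftrightarrow> distinct \<sigma> \<and> set \<sigma> = {1..n}"
  by (auto simp: perms_def permutations_of_set_def)

lemma length_perms: "\<sigma> \<in> perms n \<Longrightarrow> length \<sigma> = n"
  using distinct_card[of \<sigma>] by (auto simp: perms_iff)

lemma st_eqI:
  assumes "\<sigma> \<in> perms (length a)" "same_order \<sigma> a"
  shows "st a = \<sigma>"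
  unfolding st_def
proof (rule the_equality)
  show "\<sigma> \<in> perms (length a) \<and> (\<forall>p<length a. \<forall>q<length a. \<sigma> ! p < \<sigma> ! q \<longleftrightarrow> a ! p < a ! q)"
    using assms by (auto simp: same_order_def)
next
  fix \<tau> assume t: "\<tau> \<in> perms (length a) \<and> (\<forall>p<length a. \<forall>q<length a. \<tau> ! p < \<tau> ! q \<longleftrightarrow> a ! p < a ! q)"
  then have "same_order \<tau> a" using length_perms by (auto simp: same_order_def)
  then have "same_order \<tau> \<sigma>" using assms(2) same_order_sym same_order_trans by blast
  then show "\<tau> = \<sigma>" using same_order_set_eq t assms(1) by (auto simp: perms_iff)
qed

lemma st_perms: "distinct a \<Longrightarrow> st a \<in> perms (length a)"
  and same_order_st: "distinct a \<Longrightarrow> same_order (st a) a"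
proof -
  assume d: "distinct a"
  define \<sigma> where "\<sigma> = map (\<lambda>x. Suc (rank (set a) x)) a"
  have "distinct \<sigma>"
    unfolding \<sigma>_def using d inj_on_rank[of "set a"] by (auto simp: distinct_map inj_on_def)
  moreover have "set \<sigma> = Suc ` (rank (set a) ` set a)" unfolding \<sigma>_def by auto
  then have "set \<sigma> = {1..length a}"
    using d by (simp add: rank_image distinct_card image_Suc_lessThan)
  ultimately have p: "\<sigma> \<in> perms (length a)" by (simp add: perms_iff)
  have o: "same_order \<sigma> a"
    unfolding \<sigma>_def by (rule same_order_map) (auto simp: strict_mono_on_def rank_strict_mono)
  show "st a \<in> perms (length a)" "same_order (st a) a" using st_eqI[OF p o] p o by simp_all
qed

lemma st_eq_iff: "distinct a \<Longrightarrow> distinct b \<Longrightarrow> st a = st b \<longleftrightarrow> same_order a b"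
proof
  assume d: "distinct a" "distinct b" and "st a = st b"
  then have "same_order (st a) b" using same_order_st by simp
  then show "same_order a b" using same_order_st[OF d(1)] same_order_sym same_order_trans by blast
next
  assume d: "distinct a" "distinct b" and o: "same_order a b"
  have "same_order (st b) a" using same_order_st[OF d(2)] o same_order_sym same_order_trans by blast
  moreover have "length a = length b" using o by (simp add: same_order_def)
  ultimately show "st a = st b" using st_perms[OF d(2)] by (intro st_eqI) auto
qed

lemma gamma_perms: "gamma t \<in> perms (size t)"
proof (induction t)
  case (Node l r)
  have l: "distinct (gamma l)" "set (gamma l) = {1..size l}"
    and r: "distinct (gamma r)" "set (gamma r) = {1..size r}"
    using Node by (auto simp: perms_iff)
  have L: "set (map (\<lambda>x. x + size r) (gamma l)) = {1 + size r..size l + size r}"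
    using l by (simp only: set_map image_add_atLeastAtMost')
  have "set (gamma (Node l r)) = {1..size (Node l r)}"
    using L r by auto
  moreover have "distinct (gamma (Node l r))"
    using l r L by (auto simp: distinct_map)
  ultimately show ?case by (simp add: perms_iff)
qed (simp add: perms_iff)

lemma length_gamma [simp]: "length (gamma t) = size t"
  using gamma_perms length_perms by blast

lemma gamma_nth_le: "p < size t \<Longrightarrow> 1 \<le> gamma t ! p \<and> gamma t ! p \<le> size t"
  using gamma_perms[of t] nth_mem[of p "gamma t"] by (auto simp: perms_iff)

text \<open>In \<open>gamma (Node l r)\<close> the root carries the largest value and all values of \<open>l\<close> exceed all values of
\<open>r\<close>; hence an increasing pair cannot separate \<open>l\<close> from \<open>r\<close> and can contain the root only as its
second member.\<close>
lemma gamma_nth_less: "p < q \<Longrightarrow> q < size t \<Longrightarrow> gamma t ! p < gamma t ! q \<longleftrightarrow> in_left t p q"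
proof (induction t arbitrary: p q)
  case (Node l r)
  have nth: "gamma (Node l r) ! k = (if k < size l then gamma l ! k + size r
    else if k = size l then size (Node l r) else gamma r ! (k - Suc (size l)))" for k
    by (simp add: nth_append nth_Cons')
  show ?case
  proof (cases q "size l" rule: linorder_cases)
    case less
    then show ?thesis using Node nth by simp
  next
    case equal
    then show ?thesis using Node gamma_nth_le[of p l] by (simp add: nth del: gamma.simps)
  next
    case greater
    have "gamma r ! (q - Suc (size l)) \<le> size r"
      using gamma_nth_le[of "q - Suc (size l)" r] greater Node.prems by simp
    moreover have "1 \<le> gamma l ! p" if "p < size l" using gamma_nth_le that by blast
    ultimately show ?thesis
      using greater Node.prems Node.IH(2)[of "p - Suc (size l)" "q - Suc (size l)"]
      by (cases p "size l" rule: linorder_cases) (auto simp: nth simp del: gamma.simps)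
  qed
qed simp

lemma gamma_eq_iff: "gamma s = gamma t \<longleftrightarrow> s = t"
proof
  assume e: "gamma s = gamma t"
  then have sz: "size s = size t" using length_gamma by metis
  show "s = t"
    by (rule btree_eqI_in_left[OF sz]) (metis e sz gamma_nth_less)
qed simp

text \<open>The map moves the elements of \<open>A\<close> strictly between \<open>u\<close> and \<open>v\<close> onto consecutive values from \<open>c\<close> on, in
their order, and fixes the rest; the order between moved and fixed elements survives as long as the
new values stay within \<open>[u, v]\<close>. With \<open>c = u\<close> and \<open>c = v - n\<^sub>3 + 1\<close> this is how the entries of
the outer blocks change in the passage from \<open>\<rho>\<close> to \<open>B\<rho>\<close>.\<close>
lemma strict_mono_on_squeeze:
  fixes u v c :: nat
  assumes "finite A" "u \<le> c" "c + card {x \<in> A. u < x \<and> x < v} \<le> Suc v"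
    "\<And>x. x \<in> A \<Longrightarrow> x \<noteq> u \<and> x \<noteq> v"
  shows "strict_mono_on A (\<lambda>x. if u < x \<and> x < v then c + rank {x \<in> A. u < x \<and> x < v} x else x)"
proof (rule strict_mono_onI)
  let ?S = "{x \<in> A. u < x \<and> x < v}"
  fix x y assume xy: "x \<in> A" "y \<in> A" "x < y"
  have S: "finite ?S" using assms(1) by simp
  show "(if u < x \<and> x < v then c + rank ?S x else x) < (if u < y \<and> y < v then c + rank ?S y else y)"
    using xy(3) xy(1) assms(2,3) rank_less_card[OF S, of x] rank_strict_mono[OF S, of x y]
      assms(4)[OF xy(1)] assms(4)[OF xy(2)]
    by auto
qed

lemma image_squeeze:
  fixes u v c :: nat
  assumes "finite A" "u \<le> v" "\<And>x. x \<in> A \<Longrightarrow> x \<noteq> u \<and> x \<noteq> v"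
  defines "S \<equiv> {x \<in> A. u < x \<and> x < v}"
  shows "(\<lambda>x. if u < x \<and> x < v then c + rank S x else x) ` A =
    {x \<in> A. x < u} \<union> {c..<c + card S} \<union> {x \<in> A. x > v}"
proof -
  have "finite S" using assms by simp
  have "A = {x \<in> A. x < u} \<union> S \<union> {x \<in> A. x > v}"
    unfolding S_def using assms(3) by (blast intro: linorder_neqE_nat)
  then have "(\<lambda>x. if u < x \<and> x < v then c + rank S x else x) ` A =
     (\<lambda>x. if u < x \<and> x < v then c + rank S x else x) ` ({x \<in> A. x < u} \<union> S \<union> {x \<in> A. x > v})"
    by simp
  also have "\<dots> = {x \<in> A. x < u} \<union> (\<lambda>x. c + rank S x) ` S \<union> {x \<in> A. x > v}"
    unfolding image_Un using assms(2) by (intro arg_cong2[where f="(\<union>)"]) (auto simp: S_def image_iff)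
  also have "(\<lambda>x. c + rank S x) ` S = (+) c ` (rank S ` S)" by (simp add: image_image)
  also have "\<dots> = {c..<c + card S}"
    using rank_image[OF \<open>finite S\<close>] by (simp add: lessThan_atLeast0 add.commute)
  finally show ?thesis .
qed

section \<open>The projection on permutations\<close>

text \<open>An explicit description of the permutation \<open>B\<rho>\<close>. It rests on a count: each value in \<open>[u, v]\<close> is an
entry of the middle block or a middle entry of one of the outer blocks, so that
\<open>n\<^sub>1 + m + n\<^sub>3 = v - u + 1\<close> and the three intervals prescribed for the blocks tile \<open>[u, v]\<close>. Uniqueness
holds because a list of distinct numbers is determined by its set and its standardization.\<close>
lemma B_perm_blocks:
  fixes n m i :: nat and \<rho> :: "nat list"
  assumes perm: "\<rho> \<in> perms (n + m - 1)" and m: "1 \<le> m" and i: "1 \<le> i" "i \<le> n"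
  defines "A \<equiv> L1 m i \<rho>" and "C \<equiv> L3 m i \<rho>" and "u \<equiv> lo m i \<rho>" and "v \<equiv> hi m i \<rho>"
  defines "n1 \<equiv> mid_count m i \<rho> A" and "n3 \<equiv> mid_count m i \<rho> C"
  defines "\<alpha> \<equiv> \<lambda>x. if u < x \<and> x < v then u + rank {x \<in> set A. u < x \<and> x < v} x else x"
    and "\<beta> \<equiv> \<lambda>x. if u < x \<and> x < v then Suc (v - n3) + rank {x \<in> set C. u < x \<and> x < v} x else x"
  shows "L1 m i (B_perm n m i \<rho>) = map \<alpha> A" and "L3 m i (B_perm n m i \<rho>) = map \<beta> C"
    and "u + n1 + n3 + m = Suc v" and "distinct (map \<alpha> A @ [u + n1] @ map \<beta> C)"
proof -
  define D where "D = L2 m i \<rho>"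
  have \<rho>: "\<rho> = A @ D @ C"
    unfolding A_def D_def C_def L1_def L2_def L3_def
    by (metis append_take_drop_id drop_drop add.commute)
  have dist: "distinct \<rho>" and set_\<rho>: "set \<rho> = {1..n + m - 1}"
    using perm by (auto simp: perms_iff)
  have len: "length \<rho> = n + m - 1" using length_perms[OF perm] .
  have lA: "length A = i - 1" and lD: "length D = m" and lC: "length C = n - i"
    using len i m by (auto simp: A_def D_def C_def L1_def L2_def L3_def)
  have dA: "distinct A" and dD: "distinct D" and dC: "distinct C"
    and disj: "set A \<inter> set D = {}" "set A \<inter> set C = {}" "set D \<inter> set C = {}"
    using dist by (auto simp: \<rho>)
  have "set D \<noteq> {}" using lD m by auto
  have u: "u \<in> set D" "\<And>x. x \<in> set D \<Longrightarrow> u \<le> x" and v: "v \<in> set D" "\<And>x. x \<in> set D \<Longrightarrow> x \<le> v"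
    using \<open>set D \<noteq> {}\<close> by (auto simp: u_def v_def lo_def hi_def D_def[symmetric])
  have "u \<le> v" using u v by blast
  have "v \<in> set \<rho>" "u \<in> set \<rho>" using u v by (simp_all add: \<rho>)
  then have uv: "1 \<le> u" "v \<le> n + m - 1" unfolding set_\<rho> by auto
  define SA where "SA = {x \<in> set A. u < x \<and> x < v}"
  define SC where "SC = {x \<in> set C. u < x \<and> x < v}"
  have n1: "n1 = card SA" and n3: "n3 = card SC"
    by (simp_all add: n1_def n3_def mid_count_def SA_def SC_def u_def v_def)
  have A_ne: "x \<noteq> u \<and> x \<noteq> v" if "x \<in> set A" for x using u v disj that by blast
  have C_ne: "x \<noteq> u \<and> x \<noteq> v" if "x \<in> set C" for x using u v disj that by blast
  \<comment> \<open>every value between \<open>u\<close> and \<open>v\<close> occurs, since the entries exhaust an initial interval\<close>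
  have "{u..v} = SA \<union> set D \<union> SC"
  proof (intro equalityI subsetI)
    fix x assume x: "x \<in> {u..v}"
    then have "x \<in> set \<rho>" unfolding set_\<rho> using uv by auto
    then show "x \<in> SA \<union> set D \<union> SC"
      using x A_ne[of x] C_ne[of x] by (auto simp: \<rho> SA_def SC_def)
  qed (use u v in \<open>auto simp: SA_def SC_def\<close>)
  then have "card {u..v} = card (SA \<union> set D \<union> SC)" by simp
  also have "\<dots> = n1 + m + n3"
    using disj dD lD unfolding n1 n3
    by (subst card_Un_disjoint; (subst card_Un_disjoint)?) (auto simp: SA_def SC_def distinct_card)
  finally show total: "u + n1 + n3 + m = Suc v" using \<open>u \<le> v\<close> by simp
  \<comment> \<open>on the middle block the new values are consecutive from \<open>u + n1\<close> on\<close>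
  define \<delta> where "\<delta> x = u + n1 + rank (set D) x" for x
  have set_\<alpha>: "set (map \<alpha> A) = {x \<in> set A. x < u} \<union> {u..<u + n1} \<union> {x \<in> set A. x > v}"
    unfolding \<alpha>_def n1 SA_def set_map using A_ne \<open>u \<le> v\<close> by (intro image_squeeze) auto
  have "set (map \<beta> C) = {x \<in> set C. x < u} \<union> {Suc (v - n3)..<Suc (v - n3) + n3} \<union> {x \<in> set C. x > v}"
    unfolding \<beta>_def n3 SC_def set_map using C_ne \<open>u \<le> v\<close> by (intro image_squeeze) auto
  also have "{Suc (v - n3)..<Suc (v - n3) + n3} = {v - n3<..v}"
    using total m by auto
  finally have set_\<beta>: "set (map \<beta> C) = {x \<in> set C. x < u} \<union> {v - n3<..v} \<union> {x \<in> set C. x > v}" .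
  have "set (map \<delta> D) = (+) (u + n1) ` (rank (set D) ` set D)"
    by (simp add: \<delta>_def image_image)
  also have "\<dots> = {u + n1..v - n3}"
    using total lD dD m by (auto simp: rank_image distinct_card lessThan_atLeast0 image_add_atLeastLessThan)
  finally have set_\<delta>: "set (map \<delta> D) = {u + n1..v - n3}" .
  define \<sigma> where "\<sigma> = map \<alpha> A @ map \<delta> D @ map \<beta> C"
  have "{1..n + m - 1} \<subseteq> set \<sigma>"
  proof
    fix x assume x: "x \<in> {1..n + m - 1}"
    show "x \<in> set \<sigma>"
    proof (cases "u \<le> x \<and> x \<le> v")
      case True
      then have "x \<in> {u..<u + n1} \<union> {u + n1..v - n3} \<union> {v - n3<..v}" using total m by auto
      then show ?thesis unfolding \<sigma>_def set_append set_\<alpha> set_\<beta> set_\<delta> by blast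
    next
      case False
      have "x \<in> set \<rho>" using x set_\<rho> by simp
      moreover have "x \<notin> set D" using False u v by blast
      ultimately have "x \<in> set A \<or> x \<in> set C" by (simp add: \<rho>)
      then show ?thesis using False unfolding \<sigma>_def set_append set_\<alpha> set_\<beta> set_\<delta>
        by (auto simp: not_le)
    qed
  qed
  moreover have "set \<sigma> \<subseteq> {1..n + m - 1}"
  proof -
    have "set A \<subseteq> {1..n + m - 1}" "set C \<subseteq> {1..n + m - 1}"
      unfolding set_\<rho>[symmetric] by (auto simp: \<rho>)
    then show ?thesis
      unfolding \<sigma>_def set_append set_\<alpha> set_\<beta> set_\<delta> using uv total m by auto
  qed
  ultimately have set_\<sigma>: "set \<sigma> = {1..n + m - 1}" by blast
  have len_\<sigma>: "length \<sigma> = n + m - 1" using len by (simp add: \<sigma>_def \<rho>)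
  have dist_\<sigma>: "distinct \<sigma>" using set_\<sigma> len_\<sigma> by (intro card_distinct) simp
  have "same_order (map \<alpha> A) A"
    unfolding \<alpha>_def using A_ne total m n1 SA_def by (intro same_order_map strict_mono_on_squeeze) auto
  then have st_\<alpha>: "st (map \<alpha> A) = st A"
    using dist_\<sigma> dA by (simp add: st_eq_iff \<sigma>_def)
  have "same_order (map \<beta> C) C"
    unfolding \<beta>_def using C_ne total m n3 SC_def by (intro same_order_map strict_mono_on_squeeze) auto
  then have st_\<beta>: "st (map \<beta> C) = st C"
    using dist_\<sigma> dC by (simp add: st_eq_iff \<sigma>_def)
  have "same_order (map \<delta> D) D"
    unfolding \<delta>_def by (intro same_order_map) (auto simp: strict_mono_on_def rank_strict_mono)
  then have st_\<delta>: "st (map \<delta> D) = st D"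
    using dist_\<sigma> dD by (simp add: st_eq_iff \<sigma>_def)
  have blocks: "L1 m i \<sigma> = map \<alpha> A" "L2 m i \<sigma> = map \<delta> D" "L3 m i \<sigma> = map \<beta> C"
    using lA lD by (simp_all add: L1_def L2_def L3_def \<sigma>_def)
  have "B_perm n m i \<rho> = \<sigma>"
    unfolding B_perm_def Let_def A_def[symmetric] C_def[symmetric] D_def[symmetric]
      u_def[symmetric] v_def[symmetric] n1_def[symmetric] n3_def[symmetric]
  proof (rule the_equality)
    show "\<sigma> \<in> perms (n + m - 1) \<and> st (L1 m i \<sigma>) = st A \<and> st (L2 m i \<sigma>) = st D \<and>
      st (L3 m i \<sigma>) = st C \<and>
      set (L1 m i \<sigma>) = {x \<in> set A. x < u} \<union> {u..<u + n1} \<union> {x \<in> set A. v < x} \<and>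
      set (L2 m i \<sigma>) = {u + n1..v - n3} \<and>
      set (L3 m i \<sigma>) = {x \<in> set C. x < u} \<union> {v - n3<..v} \<union> {x \<in> set C. v < x}"
      unfolding blocks st_\<alpha> st_\<beta> st_\<delta> set_\<alpha> set_\<beta> set_\<delta>
      using dist_\<sigma> set_\<sigma> by (simp add: perms_iff)
  next
    fix \<tau>
    assume \<tau>: "\<tau> \<in> perms (n + m - 1) \<and> st (L1 m i \<tau>) = st A \<and> st (L2 m i \<tau>) = st D \<and>
      st (L3 m i \<tau>) = st C \<and>
      set (L1 m i \<tau>) = {x \<in> set A. x < u} \<union> {u..<u + n1} \<union> {x \<in> set A. v < x} \<and>
      set (L2 m i \<tau>) = {u + n1..v - n3} \<and>
      set (L3 m i \<tau>) = {x \<in> set C. x < u} \<union> {v - n3<..v} \<union> {x \<in> set C. v < x}"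
    then have "distinct \<tau>" by (simp add: perms_iff)
    then have d: "distinct (L1 m i \<tau>)" "distinct (L2 m i \<tau>)" "distinct (L3 m i \<tau>)"
      by (simp_all add: L1_def L2_def L3_def)
    have d': "distinct (map \<alpha> A)" "distinct (map \<delta> D)" "distinct (map \<beta> C)"
      using dist_\<sigma> unfolding \<sigma>_def distinct_append by blast+
    have eq: "x = y" if "distinct x" "distinct y" "st x = st y" "set x = set y" for x y
      using that same_order_set_eq st_eq_iff by blast
    have "L1 m i \<tau> = map \<alpha> A"
      by (rule eq[OF d(1) d'(1)]; unfold st_\<alpha> set_\<alpha>; use \<tau> in blast)
    moreover have "L2 m i \<tau> = map \<delta> D"
      by (rule eq[OF d(2) d'(2)]; unfold st_\<delta> set_\<delta>; use \<tau> in blast)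
    moreover have "L3 m i \<tau> = map \<beta> C"
      by (rule eq[OF d(3) d'(3)]; unfold st_\<beta> set_\<beta>; use \<tau> in blast)
    moreover have "\<tau> = L1 m i \<tau> @ L2 m i \<tau> @ L3 m i \<tau>"
      unfolding L1_def L2_def L3_def by (metis append_take_drop_id drop_drop add.commute)
    ultimately show "\<tau> = \<sigma>" by (simp add: \<sigma>_def)
  qed
  then show "L1 m i (B_perm n m i \<rho>) = map \<alpha> A" "L3 m i (B_perm n m i \<rho>) = map \<beta> C"
    using blocks by simp_all
  have "u + n1 \<in> set (map \<delta> D)" unfolding set_\<delta> using total m by auto
  then show "distinct (map \<alpha> A @ [u + n1] @ map \<beta> C)"
    using dist_\<sigma> unfolding \<sigma>_def distinct_append by auto
qed

section \<open>Moebius inversion for the two bases\<close>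

lemma lookup_scale: "Poly_Mapping.lookup (scale c x) k = c * Poly_Mapping.lookup x k"
  by (simp add: scale_def Poly_Mapping.map.rep_eq when_def)

lemma scale_0 [simp]: "scale 0 x = 0"
  and scale_1 [simp]: "scale 1 x = x"
  by (rule poly_mapping_eqI; simp add: lookup_scale)+

lemma scale_sum_left: "scale (sum f A) x = (\<Sum>a\<in>A. scale (f a) x)"
  by (rule poly_mapping_eqI) (simp add: lookup_scale lookup_sum sum_distrib_right)

lemma scale_sum_right: "scale c (sum f A) = (\<Sum>a\<in>A. scale c (f a))"
  by (rule poly_mapping_eqI) (simp add: lookup_scale lookup_sum sum_distrib_left)

lemma sum_mobius:
  "(\<Sum>r | tamari s r \<and> tamari r t. mobius s r) = (if s = t then 1 else 0)"
proof (cases "tamari s t")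
  case False
  have empty: "{r. tamari s r \<and> tamari r t} = {}" using False tamari_trans by blast
  show ?thesis unfolding empty using False tamari_refl by auto
next
  case True
  show ?thesis
  proof (cases "s = t")
    case True
    then have "{r. tamari s r \<and> tamari r t} = {t}" using tamari_antisym tamari_refl by blast
    then show ?thesis using True by (simp add: mobius.simps)
  next
    case False
    have fin: "finite {r. tamari s r \<and> tamari r t \<and> r \<noteq> t}"
      by (rule finite_subset[OF _ finite_tamari_up[of s]]) auto
    have "{r. tamari s r \<and> tamari r t} = insert t {r. tamari s r \<and> tamari r t \<and> r \<noteq> t}"
      using True tamari_refl by auto
    then have "(\<Sum>r | tamari s r \<and> tamari r t. mobius s r) =
      mobius s t + (\<Sum>r | tamari s r \<and> tamari r t \<and> r \<noteq> t. mobius s r)"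
      using fin by simp
    also have "\<dots> = 0" using True False by (simp add: mobius.simps[of s t])
    finally show ?thesis using False by simp
  qed
qed


text \<open>The Moebius function is defined by sums of \<open>\<mu>(s, r)\<close> over its second argument, whereas expanding \<open>F\<close> in
the basis \<open>M\<close> seems to ask for sums over the first one. The dual identity is avoided as follows: with
\<open>E t\<close> the sum of all \<open>M r\<close> above \<open>t\<close>, the given identity shows that \<open>E\<close> and \<open>F\<close> have the same
\<open>\<mu>\<close>-weighted sum above \<open>s\<close>, namely \<open>M s\<close>. The terms above \<open>s\<close> other than \<open>s\<close> agree by induction, and the
coefficient of the remaining one is \<open>\<mu>(s, s) = 1\<close>.\<close>
lemma F_eq_sum_M: "(F s :: btree \<Rightarrow>\<^sub>0 'k::comm_ring_1) = (\<Sum>t | tamari s t. M t)"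
proof (induction "card {t. tamari s t}" arbitrary: s rule: less_induct)
  case less
  define E :: "btree \<Rightarrow> (btree \<Rightarrow>\<^sub>0 'k)" where "E t = (\<Sum>r | tamari t r. M r)" for t
  let ?U = "{t. tamari s t}"
  have E_above: "E t = F t" if "tamari s t" "t \<noteq> s" for t
  proof -
    have "{r. tamari t r} \<subset> ?U"
      using that tamari_trans tamari_antisym tamari_refl by blast
    then show ?thesis
      using less finite_tamari_up[of s] by (simp add: E_def psubset_card_mono)
  qed
  have "(\<Sum>t\<in>?U. scale (of_int (mobius s t)) (E t)) =
    (\<Sum>t\<in>?U. \<Sum>r\<in>{r \<in> ?U. tamari t r}. scale (of_int (mobius s t)) (M r))"
  proof (rule sum.cong)
    fix t assume "t \<in> ?U"
    then have "{r \<in> ?U. tamari t r} = {r. tamari t r}" using tamari_trans by blast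
    then show "scale (of_int (mobius s t)) (E t) =
      (\<Sum>r\<in>{r \<in> ?U. tamari t r}. scale (of_int (mobius s t)) (M r))"
      by (simp add: E_def scale_sum_right)
  qed simp
  also have "\<dots> = (\<Sum>r\<in>?U. \<Sum>t\<in>{t \<in> ?U. tamari t r}. scale (of_int (mobius s t)) (M r))"
    using finite_tamari_up[of s] by (intro sum.swap_restrict)
  also have "\<dots> = (\<Sum>r\<in>?U. scale (of_int (if s = r then 1 else 0)) (M r))"
    by (simp only: scale_sum_left[symmetric] of_int_sum[symmetric] mem_Collect_eq sum_mobius)
  also have "\<dots> = (\<Sum>r\<in>?U. if s = r then M r else 0)"
    by (rule sum.cong) auto
  also have "\<dots> = M s" using finite_tamari_up[of s] tamari_refl by simp
  also have "\<dots> = (\<Sum>t\<in>?U. scale (of_int (mobius s t)) (F t))" by (simp add: M_def)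
  finally have eq: "(\<Sum>t\<in>?U. scale (of_int (mobius s t)) (E t)) =
    (\<Sum>t\<in>?U. scale (of_int (mobius s t)) (F t))" .
  have "(\<Sum>t\<in>?U. scale (of_int (mobius s t)) (X t)) =
      X s + (\<Sum>t\<in>?U - {s}. scale (of_int (mobius s t)) (X t))" for X :: "btree \<Rightarrow> (btree \<Rightarrow>\<^sub>0 'k)"
    using finite_tamari_up[of s] tamari_refl by (subst sum.remove[of _ s]) (auto simp: mobius.simps)
  moreover have "(\<Sum>t\<in>?U - {s}. scale (of_int (mobius s t)) (E t)) =
      (\<Sum>t\<in>?U - {s}. scale (of_int (mobius s t)) (F t))"
    using E_above by (intro sum.cong) auto
  ultimately have "E s = F s" using eq by simp
  then show ?case by (simp add: E_def)
qed

lemma lookup_M: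
  "Poly_Mapping.lookup (M s :: btree \<Rightarrow>\<^sub>0 'k::comm_ring_1) t = (if tamari s t then of_int (mobius s t) else 0)"
proof -
  have "Poly_Mapping.lookup (M s :: btree \<Rightarrow>\<^sub>0 'k) t = (\<Sum>r | tamari s r. if r = t then of_int (mobius s t) else 0)"
    unfolding M_def lookup_sum lookup_scale F_def lookup_single
    by (rule sum.cong) (auto simp: when_def)
  then show ?thesis using finite_tamari_up[of s] by simp
qed

lemma circ_M_M:
  "circ i (M s) (M t :: btree \<Rightarrow>\<^sub>0 'k::comm_ring_1) =
    (\<Sum>s' | tamari s s'. \<Sum>t' | tamari t t'.
       scale (of_int (mobius s s') * of_int (mobius t t')) (F (graft_at i s' t')))"
proof -
  have keys: "Poly_Mapping.keys (M s :: btree \<Rightarrow>\<^sub>0 'k) \<subseteq> {t. tamari s t}" for s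
    by (auto simp: in_keys_iff lookup_M split: if_splits)
  have "circ i (M s) (M t :: btree \<Rightarrow>\<^sub>0 'k) =
    (\<Sum>s' | tamari s s'. \<Sum>t' | tamari t t'.
       scale (Poly_Mapping.lookup (M s) s' * Poly_Mapping.lookup (M t) t') (F (graft_at i s' t')))"
    unfolding circ_def
    by (intro sum.mono_neutral_cong_left[OF finite_tamari_up keys]) (auto intro!: sum.mono_neutral_cong_left[OF finite_tamari_up keys] sum.neutral simp: in_keys_iff)
  then show ?thesis by (simp add: lookup_M)
qed

section \<open>The projection on trees and the composition of the M basis\<close>

lemma collapse_eq_iff:
  "0 < m \<Longrightarrow> collapse b m p' = p \<longleftrightarrow>
    (if p < b then p' = p else if p = b then b \<le> p' \<and> p' < b + m else p' = p + m - 1)"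
  by (auto simp: collapse_def)

lemma contracted_iff:
  assumes "0 < m"
  shows "p < b \<Longrightarrow> q < b \<Longrightarrow> contracted b m r p q \<longleftrightarrow> in_left r p q"
    and "b < p \<Longrightarrow> b < q \<Longrightarrow> contracted b m r p q \<longleftrightarrow> in_left r (p + m - 1) (q + m - 1)"
    and "p < b \<Longrightarrow> b < q \<Longrightarrow> contracted b m r p q \<longleftrightarrow> in_left r p (q + m - 1)"
    and "p < b \<Longrightarrow> contracted b m r p b \<longleftrightarrow> (\<exists>k<m. in_left r p (b + k))"
    and "b < q \<Longrightarrow> contracted b m r b q \<longleftrightarrow> (\<exists>k<m. in_left r (b + k) (q + m - 1))"
proof -
  have block: "(\<exists>p'\<ge>b. p' < b + m \<and> X p') \<longleftrightarrow> (\<exists>k<m. X (b + k))" for X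
    by (metis le_add1 nat_add_left_cancel_less le_Suc_ex)
  show "p < b \<Longrightarrow> contracted b m r p b \<longleftrightarrow> (\<exists>k<m. in_left r p (b + k))"
    using block[of "in_left r p"] assms by (auto simp: contracted_def collapse_eq_iff)
  show "b < q \<Longrightarrow> contracted b m r b q \<longleftrightarrow> (\<exists>k<m. in_left r (b + k) (q + m - 1))"
    using block[of "\<lambda>x. in_left r x (q + m - 1)"] assms by (auto simp: contracted_def collapse_eq_iff)
qed (use assms in \<open>simp_all add: contracted_def collapse_eq_iff\<close>)

text \<open>By \<open>gamma_nth_less\<close> it is enough to compare orders of entries. Passing from \<open>\<rho>\<close> to \<open>B\<rho>\<close> keeps the order
within each outer block. The entry standing for the middle block exceeds an entry \<open>c\<close> on its left iff
\<open>c < v\<close>, that is, iff \<open>c\<close> is below some entry of the block; it is below an entry \<open>d\<close> on its right iff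
\<open>u < d\<close>, that is, iff \<open>d\<close> is above some entry of the block. Two entries \<open>c\<close> and \<open>d\<close> on different sides are
increasing iff they were so before or both of these conditions hold. These are the pairs of the
contracted relation, closed under paths through the contracted point.\<close>
lemma P_tree_eq:
  assumes r: "r \<in> Y (n + m - 1)" and m: "1 \<le> m" and b: "b < n"
    and x: "size x = n" "\<And>p q. p < q \<Longrightarrow> q < n \<Longrightarrow> in_left x p q \<longleftrightarrow>
        contracted b m r p q \<or> contracted b m r p b \<and> contracted b m r b q"
    and y: "size y = m" "\<And>p q. p < q \<Longrightarrow> q < m \<Longrightarrow> in_left y p q \<longleftrightarrow> in_left r (p + b) (q + b)"
  shows "P_tree n m (Suc b) r = (x, y)"
proof -
  have size_r: "size r = n + m - 1" using r by (simp add: Y_def)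
  have "P_perm n m (Suc b) (gamma r) = (gamma x, gamma y)"
  proof (cases "m = 1")
    case True
    \<comment> \<open>a block of size 1 is contracted trivially, and the closure through \<open>b\<close> adds nothing\<close>
    have "collapse b m = id" using True by (auto simp: collapse_def)
    then have contracted: "contracted b m r p q \<longleftrightarrow> in_left r p q" for p q
      by (simp add: contracted_def)
    have "x = r"
    proof (rule btree_eqI_in_left)
      show "size x = size r" using x(1) size_r True by simp
      fix p q assume "p < q" "q < size r"
      then show "in_left x p q = in_left r p q"
        using x(2)[of p q, unfolded contracted] size_r True in_left_trans[of r p b q] by auto
    qed
    moreover have "y = Node Leaf Leaf"
    proof (cases y)
      case (Node l r)
      then show ?thesis using y(1) True by (cases l; cases r) auto
    qed (use y(1) True in simp)
    ultimately show ?thesis using True by (simp add: P_perm_def)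
  next
    case False
    define \<rho> where "\<rho> = gamma r"
    define A where "A = L1 m (Suc b) \<rho>"
    define D where "D = L2 m (Suc b) \<rho>"
    define C where "C = L3 m (Suc b) \<rho>"
    define u where "u = lo m (Suc b) \<rho>"
    define v where "v = hi m (Suc b) \<rho>"
    define n1 where "n1 = mid_count m (Suc b) \<rho> A"
    define n3 where "n3 = mid_count m (Suc b) \<rho> C"
    define SA where "SA = {x \<in> set A. u < x \<and> x < v}"
    define SC where "SC = {x \<in> set C. u < x \<and> x < v}"
    define \<alpha> where "\<alpha> = (\<lambda>x. if u < x \<and> x < v then u + rank SA x else x)"
    define \<beta> where "\<beta> = (\<lambda>x. if u < x \<and> x < v then Suc (v - n3) + rank SC x else x)"
    have perm: "\<rho> \<in> perms (n + m - 1)" using gamma_perms[of r] size_r by (simp add: \<rho>_def)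
    have len: "length \<rho> = n + m - 1" using length_perms[OF perm] .
    have "distinct \<rho>" using perm by (simp add: perms_iff)
    have nth_eq: "\<rho> ! p = \<rho> ! q \<longleftrightarrow> p = q" if "p < n + m - 1" "q < n + m - 1" for p q
      using \<open>distinct \<rho>\<close> len that by (simp add: nth_eq_iff_index_eq)
    have order: "in_left r p q \<longleftrightarrow> \<rho> ! p < \<rho> ! q" if "p < q" "q < n + m - 1" for p q
      using gamma_nth_less[of p q r] that size_r by (simp add: \<rho>_def)
    have B: "L1 m (Suc b) (B_perm n m (Suc b) \<rho>) = map \<alpha> A"
        "L3 m (Suc b) (B_perm n m (Suc b) \<rho>) = map \<beta> C"
      and total: "u + n1 + n3 + m = Suc v"
      and dist_z: "distinct (map \<alpha> A @ [u + n1] @ map \<beta> C)"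
      using B_perm_blocks[OF perm m, of "Suc b"] b
      unfolding \<alpha>_def \<beta>_def A_def C_def u_def v_def n1_def n3_def SA_def SC_def by simp_all
    have n1: "n1 = card SA" and n3: "n3 = card SC"
      by (simp_all add: n1_def n3_def mid_count_def SA_def SC_def u_def v_def)
    have lA: "length A = b" and lC: "length C = n - Suc b" and lD: "length D = m"
      using len b m by (simp_all add: A_def C_def D_def L1_def L2_def L3_def)
    have nth_A: "A ! p = \<rho> ! p" if "p < b" for p using that by (simp add: A_def L1_def)
    have nth_D: "D ! k = \<rho> ! (b + k)" if "k < m" for k
      using that len b by (simp add: D_def L2_def)
    have nth_C: "C ! k = \<rho> ! (b + m + k)" if "k < n - Suc b" for k
      using that len b m by (simp add: C_def L3_def)
    have set_D: "d \<in> set D \<longleftrightarrow> (\<exists>k<m. d = \<rho> ! (b + k))" for d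
      using lD nth_D by (auto simp: in_set_conv_nth)
    have "set D \<noteq> {}" using lD m by auto
    have u_Min: "u = Min (set D)" and v_Max: "v = Max (set D)"
      by (simp_all add: u_def v_def lo_def hi_def D_def)
    have u: "u \<in> set D" "\<And>z. u < z \<longleftrightarrow> (\<exists>k<m. \<rho> ! (b + k) < z)"
      unfolding u_Min using \<open>set D \<noteq> {}\<close> by (rule Min_in[OF finite_set], subst Min_less_iff) (auto simp: Bex_def set_D)
    have v: "v \<in> set D" "\<And>z. z < v \<longleftrightarrow> (\<exists>k<m. z < \<rho> ! (b + k))"
      unfolding v_Max using \<open>set D \<noteq> {}\<close> by (rule Max_in[OF finite_set], subst Max_gr_iff) (auto simp: Bex_def set_D)
    have ne: "\<rho> ! p \<noteq> u \<and> \<rho> ! p \<noteq> v" if "p < n + m - 1" "p < b \<or> b + m \<le> p" for p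
    proof -
      obtain k l where "k < m" "u = \<rho> ! (b + k)" "l < m" "v = \<rho> ! (b + l)"
        using u(1) v(1) set_D by blast
      then show ?thesis using that b by (auto simp: nth_eq)
    qed
    have ne_A: "z \<noteq> u \<and> z \<noteq> v" if z: "z \<in> set A" for z
    proof -
      obtain p where "p < b" "z = \<rho> ! p"
        using z lA nth_A by (auto simp: in_set_conv_nth)
      then show ?thesis using ne[of p] b by simp
    qed
    have ne_C: "z \<noteq> u \<and> z \<noteq> v" if z: "z \<in> set C" for z
    proof -
      obtain k where "k < n - Suc b" "z = \<rho> ! (b + m + k)"
        using z lC nth_C by (auto simp: in_set_conv_nth)
      then show ?thesis using ne[of "b + m + k"] m by simp
    qed
    have mono_\<alpha>: "strict_mono_on (set A) \<alpha>"
      unfolding \<alpha>_def SA_def using ne_A total m n1 SA_def by (intro strict_mono_on_squeeze) auto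
    have mono_\<beta>: "strict_mono_on (set C) \<beta>"
      unfolding \<beta>_def SC_def using ne_C total m n3 SC_def by (intro strict_mono_on_squeeze) auto
    have \<alpha>_bounds: "if u < z \<and> z < v then u \<le> \<alpha> z \<and> \<alpha> z < u + n1 else \<alpha> z = z" if "z \<in> set A" for z
      using rank_less_card[of SA z] that by (auto simp: \<alpha>_def n1 SA_def)
    have \<beta>_bounds: "if u < z \<and> z < v then v - n3 < \<beta> z \<and> \<beta> z \<le> v else \<beta> z = z" if "z \<in> set C" for z
      using rank_less_card[of SC z] that total m by (auto simp: \<beta>_def n3 SC_def)
    define Z where "Z = map \<alpha> A @ [u + n1] @ map \<beta> C"
    have nth_Z: "p < b \<Longrightarrow> Z ! p = \<alpha> (\<rho> ! p)" "Z ! b = u + n1"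
       "b < p \<Longrightarrow> p < n \<Longrightarrow> Z ! p = \<beta> (\<rho> ! (p + m - 1))" for p
      using lA lC nth_A nth_C[of "p - Suc b"] m by (auto simp: Z_def nth_append add.commute)
    have in_A: "\<rho> ! p \<in> set A" if "p < b" for p
      using nth_mem[of p A] nth_A that lA by simp
    have in_C: "\<rho> ! (p + m - 1) \<in> set C" if "b < p" "p < n" for p
      using nth_mem[of "p - Suc b" C] nth_C[of "p - Suc b"] that lC m by (simp add: add.commute)
    have "0 < m" using m by simp
    note contracted = contracted_iff[OF \<open>0 < m\<close>]
    have into: "contracted b m r p b \<longleftrightarrow> \<rho> ! p < v" if "p < b" for p
      unfolding contracted(4)[OF that] v(2) using that b by (intro ex_cong1 conj_cong refl order) auto
    have out: "contracted b m r b q \<longleftrightarrow> u < \<rho> ! (q + m - 1)" if "b < q" "q < n" for q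
      unfolding contracted(5)[OF that(1)] u(2) using that by (intro ex_cong1 conj_cong refl order) auto
    have z_order: "gamma x ! p < gamma x ! q \<longleftrightarrow> Z ! p < Z ! q" if "p < q" "q < n" for p q
    proof -
      have g: "gamma x ! p < gamma x ! q \<longleftrightarrow>
          contracted b m r p q \<or> contracted b m r p b \<and> contracted b m r b q"
        using gamma_nth_less[of p q x] that x by simp
      consider "q < b" | "p < b" "q = b" | "p < b" "b < q" | "p = b" | "b < p"
        using \<open>p < q\<close> by linarith
      then show ?thesis
      proof cases
        case 1
        then have "\<not> contracted b m r b q" using contracted_le[of b m r b q] by auto
        then have "gamma x ! p < gamma x ! q \<longleftrightarrow> \<rho> ! p < \<rho> ! q"
          using g contracted(1) order 1 that b by simp
        then show ?thesis using 1 that nth_Z(1) in_A strict_mono_on_less[OF mono_\<alpha>] by simp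
      next
        case 2
        then have "gamma x ! p < gamma x ! q \<longleftrightarrow> \<rho> ! p < v" using g into by blast
        then show ?thesis
          using 2 nth_Z \<alpha>_bounds[OF in_A, of p] ne_A[OF in_A, of p] total m
          by (auto split: if_splits)
      next
        case 3
        define c where "c = \<rho> ! p"
        define d where "d = \<rho> ! (q + m - 1)"
        have "gamma x ! p < gamma x ! q \<longleftrightarrow> c < d \<or> c < v \<and> u < d"
          unfolding g contracted(3)[OF 3] into[OF 3(1)] out[OF 3(2) \<open>q < n\<close>] c_def d_def
          using order[of p "q + m - 1"] 3 that m by simp
        moreover have "c \<noteq> d" using nth_eq[of p "q + m - 1"] 3 that m by (simp add: c_def d_def)
        moreover have "c \<in> set A" "d \<in> set C" using in_A in_C 3 that by (simp_all add: c_def d_def)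
        note \<alpha>_bounds[OF this(1)] \<beta>_bounds[OF this(2)] ne_A[OF this(1)] ne_C[OF this(2)]
        moreover have "Z ! p = \<alpha> c" "Z ! q = \<beta> d" using nth_Z 3 that by (simp_all add: c_def d_def)
        ultimately show ?thesis using total m by (auto split: if_splits)
      next
        case 4
        then have "gamma x ! p < gamma x ! q \<longleftrightarrow> u < \<rho> ! (q + m - 1)"
          using g out[of q] 4 that by auto
        then show ?thesis
          using 4 that nth_Z \<beta>_bounds[OF in_C, of q] ne_C[OF in_C, of q] total m
          by (auto split: if_splits)
      next
        case 5
        then have "\<not> contracted b m r p b" using contracted_le[of b m r p b] by auto
        then have "gamma x ! p < gamma x ! q \<longleftrightarrow> \<rho> ! (p + m - 1) < \<rho> ! (q + m - 1)"
          using g contracted(2) order[of "p + m - 1" "q + m - 1"] 5 that m by simp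
        then show ?thesis using 5 that nth_Z(3) in_C strict_mono_on_less[OF mono_\<beta>] by simp
      qed
    qed
    have len_Z: "length Z = n" using lA lC b by (simp add: Z_def)
    have dx: "distinct (gamma x)" and dy: "distinct (gamma y)"
      using gamma_perms by (auto simp: perms_iff)
    have "st Z = gamma x"
    proof (rule st_eqI)
      show "gamma x \<in> perms (length Z)" using gamma_perms[of x] len_Z x(1) by simp
      show "same_order (gamma x) Z"
        using dx dist_z z_order len_Z x(1) by (intro same_orderI) (auto simp: Z_def)
    qed
    moreover have "st D = gamma y"
    proof (rule st_eqI)
      show "gamma y \<in> perms (length D)" using gamma_perms[of y] lD y(1) by simp
      show "same_order (gamma y) D"
      proof (rule same_orderI)
        show "distinct D" using \<open>distinct \<rho>\<close> by (simp add: D_def L2_def)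
        fix p q assume pq: "p < q" "q < length D"
        then show "gamma y ! p < gamma y ! q \<longleftrightarrow> D ! p < D ! q"
          using gamma_nth_less[of p q y] y order[of "b + p" "b + q"] b lD nth_D
          by (simp add: add.commute)
      qed (use dy lD y(1) in auto)
    qed
    ultimately show ?thesis
      using False B unfolding P_perm_def Let_def \<rho>_def[symmetric] D_def[symmetric] A_def[symmetric]
        u_def[symmetric] n1_def[symmetric]
      by (simp add: Z_def)
  qed
  then show ?thesis
    unfolding P_tree_def using x(1) y(1)
    by (intro the_equality) (auto simp: Y_def gamma_eq_iff)
qed

lemma P_tree_adjoint:
  assumes "r \<in> Y (n + m - 1)" "1 \<le> m" "1 \<le> i" "i \<le> n" "s \<in> Y n" "t \<in> Y m"
  shows "tamari (graft_at i s t) r \<longleftrightarrow> tamari s (fst (P_tree n m i r)) \<and> tamari t (snd (P_tree n m i r))"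
proof -
  obtain b where i: "i = Suc b" using assms(3) by (cases i) auto
  have sz: "size s = n" "size t = m" "size r = n + m - 1" using assms by (auto simp: Y_def)
  obtain x where x: "size x = n" "\<And>p q. p < q \<Longrightarrow> q < n \<Longrightarrow> in_left x p q \<longleftrightarrow>
        contracted b m r p q \<or> contracted b m r p b \<and> contracted b m r b q"
    using ex_btree_contraction[of m n b r] assms(2) by auto
  obtain y where y: "size y = m" "\<And>p q. p < q \<Longrightarrow> q < m \<Longrightarrow> in_left y p q \<longleftrightarrow> in_left r (p + b) (q + b)"
    using ex_btree_restriction[of m r b] by blast
  have "P_tree n m i r = (x, y)"
    unfolding i using assms i x y by (intro P_tree_eq) auto
  moreover have "tamari (graft_at (Suc b) s t) r \<longleftrightarrow> tamari s x \<and> tamari t y"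
    using assms i sz x y by (intro graft_at_tamari_iff) auto
  ultimately show ?thesis by (simp add: i)
qed

theorem proposition4p5:
  fixes n m i :: nat and s t :: btree
  assumes "n \<ge> 1" and "m \<ge> 1"
    and "s \<in> Y n" and "t \<in> Y m"
    and "1 \<le> i" and "i \<le> n"
  shows "circ i (M s) (M t) =
    (\<Sum>r | r \<in> Y (n + m - 1) \<and> P_tree n m i r = (s, t). (M r :: btree \<Rightarrow>\<^sub>0 'k::comm_ring_1))"
proof -
  let ?N = "n + m - 1"
  let ?U = "{s'. tamari s s'}" and ?V = "{t'. tamari t t'}"
  define P1 where "P1 r = fst (P_tree n m i r)" for r
  define P2 where "P2 r = snd (P_tree n m i r)" for r
  define \<mu> :: "btree \<Rightarrow> btree \<Rightarrow> 'k" where "\<mu> a b = of_int (mobius a b)" for a b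
  have UV: "s' \<in> Y n" "t' \<in> Y m" if "s' \<in> ?U" "t' \<in> ?V" for s' t'
    using assms that by (auto simp: Y_def dest: tamari_size)
  have F_graft: "F (graft_at i s' t') = (\<Sum>r\<in>{r \<in> Y ?N. tamari s' (P1 r) \<and> tamari t' (P2 r)}. M r :: btree \<Rightarrow>\<^sub>0 'k)"
    if "s' \<in> ?U" "t' \<in> ?V" for s' t'
  proof -
    have "t' \<noteq> Leaf" using UV[OF that] assms(2) by (auto simp: Y_def)
    then have "size (graft_at i s' t') = ?N"
      using UV[OF that] assms by (simp add: size_graft_at Y_def)
    then have "{r. tamari (graft_at i s' t') r} = {r \<in> Y ?N. tamari (graft_at i s' t') r}"
      by (auto simp: Y_def dest: tamari_size)
    also have "\<dots> = {r \<in> Y ?N. tamari s' (P1 r) \<and> tamari t' (P2 r)}"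
      using P_tree_adjoint UV[OF that] assms by (auto simp: P1_def P2_def)
    finally show ?thesis by (simp add: F_eq_sum_M)
  qed
  have delta: "(\<Sum>b\<in>{b. tamari a b \<and> tamari b c}. \<mu> a b) = (if a = c then 1 else 0)" for a c
    using sum_mobius[of a c] unfolding \<mu>_def of_int_sum[symmetric] by simp
  have "circ i (M s) (M t) =
    (\<Sum>(s', t')\<in>?U \<times> ?V. scale (\<mu> s s' * \<mu> t t') (F (graft_at i s' t')) :: btree \<Rightarrow>\<^sub>0 'k)"
    by (simp add: circ_M_M \<mu>_def sum.cartesian_product)
  also have "\<dots> = (\<Sum>z\<in>?U \<times> ?V. \<Sum>r\<in>{r \<in> Y ?N. tamari (fst z) (P1 r) \<and> tamari (snd z) (P2 r)}.
      scale (\<mu> s (fst z) * \<mu> t (snd z)) (M r))"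
    by (rule sum.cong) (auto simp: F_graft scale_sum_right)
  also have "\<dots> = (\<Sum>r\<in>Y ?N. \<Sum>z\<in>{z \<in> ?U \<times> ?V. tamari (fst z) (P1 r) \<and> tamari (snd z) (P2 r)}.
      scale (\<mu> s (fst z) * \<mu> t (snd z)) (M r))"
    by (rule sum.swap_restrict) (simp_all add: finite_Y finite_tamari_up)
  also have "\<dots> = (\<Sum>r\<in>Y ?N. if P_tree n m i r = (s, t) then M r else 0)"
  proof (rule sum.cong)
    fix r
    have "{z \<in> ?U \<times> ?V. tamari (fst z) (P1 r) \<and> tamari (snd z) (P2 r)} =
      {s'. tamari s s' \<and> tamari s' (P1 r)} \<times> {t'. tamari t t' \<and> tamari t' (P2 r)}" by auto
    then have "(\<Sum>z\<in>{z \<in> ?U \<times> ?V. tamari (fst z) (P1 r) \<and> tamari (snd z) (P2 r)}. \<mu> s (fst z) * \<mu> t (snd z)) =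
      (if s = P1 r then 1 else 0) * (if t = P2 r then 1 else 0)"
      by (simp only: delta[symmetric] sum_product sum.cartesian_product case_prod_unfold)
    then show "(\<Sum>z\<in>{z \<in> ?U \<times> ?V. tamari (fst z) (P1 r) \<and> tamari (snd z) (P2 r)}.
        scale (\<mu> s (fst z) * \<mu> t (snd z)) (M r)) =
      (if P_tree n m i r = (s, t) then M r else (0 :: btree \<Rightarrow>\<^sub>0 'k))"
      unfolding scale_sum_left[symmetric] by (auto simp: P1_def P2_def prod_eq_iff)
  qed simp
  also have "\<dots> = (\<Sum>r | r \<in> Y ?N \<and> P_tree n m i r = (s, t). M r)"
    by (simp add: sum.inter_filter finite_Y)
  finally show ?thesis .
qed

end
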